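(* Let $n\in\mathbb{Z}_{>0}$ and let $\nu$ and $\pi$ be partitions of $n$. Let $R=(R_{\nu\pi}(q))$ be the matrix with rows and columns indexed by partitions of $n$ given by $$m_\nu\left[\frac{X}{1-q^{-1}}\right]=\sum_{\pi}R_{\nu\pi}(q)\,m_\pi[X].$$ Then $$R_{\nu\pi}(q)=\sum_{w\in S_n}q^{n-\ell(\nu)}\,\kappa_{\nu,w}\,C_{w,\pi}\,\frac{1}{[\pi]!}.$$
   Context: $m_\nu$ are the monomial symmetric functions; $\ell(\nu)$ is the number of parts of $\nu$. Plethystic notation: for a symmetric function $f$, $f[X]=f(x)$ and $f\left[\frac{X}{1-q^{-1}}\right]$ is the image of $f$ under the algebra homomorphism sending the power sum $p_k$ to $\frac{p_k}{1-q^{-k}}$ for all $k\ge1$. Expansion matrix: conjugacy classes $\mathcal{W}_\mu$ of $W=S_n$ are indexed by partitions $\mu$ of $n$ (cycle type); $s_i$ are the simple reflections (adjacent transpositions) and $\ell(w)$ is the length (number of inversions) of $w\in S_n$. The expansion matrix $\kappa=(\kappa_{\nu,w})$, with rows indexed by partitions $\nu$ of $n$ and columns indexed by $w\in S_n$, is given by: (a) $\kappa_{\nu,\gamma_\mu}=\delta_{\mu\nu}$ if $\gamma_\mu$ is minimal length in the conjugacy class $\mathcal{W}_\mu$; (b) $\kappa_{\nu,s_iw}=\kappa_{\nu,ws_i}$ if $\ell(s_iw)=\ell(ws_i)$ and $\ell(s_iw)=\ell(w)+1$; (c) $\kappa_{\nu,s_iws_i}=q\kappa_{\nu,w}+(q-1)\kappa_{\nu,ws_i}$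 if $\ell(s_iws_i)=\ell(w)+2$. Algebraically, $\kappa$ contains the coefficients of the Geck–Rouquier basis of the center of the Iwahori–Hecke algebra $H$ of $S_n$ (with standard basis $T_w$, $w\in S_n$, and $T_{s_i}^2=(q-1)T_{s_i}+q$) when expanded in the basis $\{q^{-\ell(w)}T_{w^{-1}}\mid w\in S_n\}$ of $H$. Contraction matrix: $C=(C_{w,\pi})$, where $C_{w,\pi}=1$ if $w\in W_\pi$ and $C_{w,\pi}=0$ if $w\notin W_\pi$, and $W_\pi=S_{\pi_1}\times\cdots\times S_{\pi_\ell}\subseteq S_n$ is the Young subgroup corresponding to the partition $\pi=(\pi_1,\ldots,\pi_\ell)$ (permuting consecutive blocks of sizes $\pi_1,\ldots,\pi_\ell$). For $k\in\mathbb{Z}_{>0}$, $[k]=1+q+\cdots+q^{k-1}$ and $[k]!=[k][k-1]\cdots[2][1]$; and $[\pi]!=[\pi_1]!\cdots[\pi_\ell]!$.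
   Formalization: The printed formula is false (for n=1, R=1/(1-q^{-1}) but the right side is 1); the formal theorem multiplies the right-hand side by (1/(1-q^{-1}))^{ℓ(ν)}, so the prefactor is q^n/(q-1)^{ℓ(ν)} instead of q^{n-ℓ(ν)}. *)

theory Defs
  imports
    "HOL-Library.Poly_Mapping"
    "HOL-Library.Multiset"
    "HOL-Combinatorics.Combinatorics"
    "HOL-Computational_Algebra.Polynomial"
    "HOL-Computational_Algebra.Fraction_Field"
begin

section \<open>Partitions\<close>

definition partitions :: "nat \<Rightarrow> nat list set" where
  "partitions n = {\<mu>. sorted_wrt (\<ge>) \<mu> \<and> (\<forall>k\<in>set \<mu>. 0 < k) \<and> sum_list \<mu> = n}"

lemma finite_partitions: "finite (partitions n)"
proof (rule finite_subset)
  have "length xs \<le> sum_list xs" if "\<forall>k\<in>set xs. 0 < k" for xs :: "nat list"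
    using that by (induction xs) auto
  then show "partitions n \<subseteq> {xs. set xs \<subseteq> {..n} \<and> length xs \<le> n}"
    by (auto simp: partitions_def member_le_sum_list)
qed (simp add: finite_lists_length_le)


section \<open>The ring of symmetric functions\<close>

text \<open>
  An exponent vector \<open>\<alpha> :: nat \<Rightarrow>\<^sub>0 nat\<close> stands for the monomial \<open>x\<^sup>\<alpha>\<close> in the infinitely many
  variables \<open>x\<^sub>0, x\<^sub>1, x\<^sub>2, \<dots>\<close>.  A symmetric function is a formal power series, given by its
  coefficient function, that has bounded degree and is invariant under permutation of the
  variables.
\<close>

definition mdegree :: "(nat \<Rightarrow>\<^sub>0 nat) \<Rightarrow> nat" where
  "mdegree \<alpha> = (\<Sum>i\<in>Poly_Mapping.keys \<alpha>. Poly_Mapping.lookup \<alpha> i)"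

definition is_symfun :: "((nat \<Rightarrow>\<^sub>0 nat) \<Rightarrow> 'a::zero) \<Rightarrow> bool" where
  "is_symfun f \<longleftrightarrow>
     (\<exists>d. \<forall>\<alpha>. f \<alpha> \<noteq> 0 \<longrightarrow> mdegree \<alpha> \<le> d) \<and>
     (\<forall>\<sigma> \<alpha>. bij \<sigma> \<longrightarrow> f (Poly_Mapping.map_key \<sigma> \<alpha>) = f \<alpha>)"

typedef (overloaded) 'a symfun = "{f :: (nat \<Rightarrow>\<^sub>0 nat) \<Rightarrow> 'a::zero. is_symfun f}"
  morphisms mcoeff Abs_symfun
  by (rule exI[of _ "\<lambda>_. 0"]) (simp add: is_symfun_def)

setup_lifting type_definition_symfun

definition splits :: "(nat \<Rightarrow>\<^sub>0 nat) \<Rightarrow> ((nat \<Rightarrow>\<^sub>0 nat) \<times> (nat \<Rightarrow>\<^sub>0 nat)) set" where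
  "splits \<alpha> = {(\<beta>, \<gamma>). \<beta> + \<gamma> = \<alpha>}"

definition conv ::
    "((nat \<Rightarrow>\<^sub>0 nat) \<Rightarrow> 'a) \<Rightarrow> ((nat \<Rightarrow>\<^sub>0 nat) \<Rightarrow> 'a) \<Rightarrow> (nat \<Rightarrow>\<^sub>0 nat) \<Rightarrow> 'a::comm_ring_1" where
  "conv f g \<alpha> = (\<Sum>(\<beta>, \<gamma>)\<in>splits \<alpha>. f \<beta> * g \<gamma>)"

lemma finite_splits: "finite (splits \<alpha>)"
proof -
  let ?F = "{h. \<forall>i. (i \<in> Poly_Mapping.keys \<alpha> \<longrightarrow> h i \<in> {..mdegree \<alpha>})
              \<and> (i \<notin> Poly_Mapping.keys \<alpha> \<longrightarrow> h i = (0::nat))}"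
  let ?D = "{\<beta>. \<exists>\<gamma>. \<beta> + \<gamma> = \<alpha>}"
  have "finite ?F"
    by (rule finite_set_of_finite_funs) auto
  moreover have "Poly_Mapping.lookup ` ?D \<subseteq> ?F"
  proof (clarsimp, intro conjI impI)
    fix \<beta> \<gamma> :: "nat \<Rightarrow>\<^sub>0 nat" and i
    have le: "Poly_Mapping.lookup \<beta> i \<le> Poly_Mapping.lookup (\<beta> + \<gamma>) i"
      by (simp add: lookup_add)
    { assume "i \<in> Poly_Mapping.keys (\<beta> + \<gamma>)"
      then have "Poly_Mapping.lookup (\<beta> + \<gamma>) i \<le> mdegree (\<beta> + \<gamma>)"
        unfolding mdegree_def by (intro member_le_sum) auto
      with le show "Poly_Mapping.lookup \<beta> i \<le> mdegree (\<beta> + \<gamma>)" by simp }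
    { assume "i \<notin> Poly_Mapping.keys (\<beta> + \<gamma>)"
      with le show "Poly_Mapping.lookup \<beta> i = 0" by (simp add: in_keys_iff) }
  qed
  ultimately have "finite (Poly_Mapping.lookup ` ?D)"
    by (rule finite_subset[rotated])
  then have D: "finite ?D"
    by (rule finite_imageD) (simp add: inj_on_def poly_mapping_eqI)
  have "splits \<alpha> \<subseteq> ?D \<times> ?D"
    unfolding splits_def by (auto, metis add.commute)
  then show ?thesis
    by (rule finite_subset) (simp add: D)
qed

lemma mdegree_superset:
  assumes "finite A" "Poly_Mapping.keys \<alpha> \<subseteq> A"
  shows "mdegree \<alpha> = (\<Sum>i\<in>A. Poly_Mapping.lookup \<alpha> i)"
  unfolding mdegree_def
  using assms by (intro sum.mono_neutral_left) (auto simp: in_keys_iff)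

lemma mdegree_add: "mdegree (\<alpha> + \<beta>) = mdegree \<alpha> + mdegree \<beta>"
proof -
  let ?A = "Poly_Mapping.keys \<alpha> \<union> Poly_Mapping.keys \<beta>"
  have "mdegree (\<alpha> + \<beta>) = (\<Sum>i\<in>?A. Poly_Mapping.lookup (\<alpha> + \<beta>) i)"
    by (rule mdegree_superset) (auto simp: in_keys_iff lookup_add)
  also have "\<dots> = (\<Sum>i\<in>?A. Poly_Mapping.lookup \<alpha> i) + (\<Sum>i\<in>?A. Poly_Mapping.lookup \<beta> i)"
    by (simp add: lookup_add sum.distrib)
  also have "\<dots> = mdegree \<alpha> + mdegree \<beta>"
    by (simp add: mdegree_superset[symmetric])
  finally show ?thesis .
qed

lemma map_key_inv:
  assumes "bij \<sigma>"
  shows "Poly_Mapping.map_key \<sigma> (Poly_Mapping.map_key (inv \<sigma>) \<alpha>) = \<alpha>"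
    and "Poly_Mapping.map_key (inv \<sigma>) (Poly_Mapping.map_key \<sigma> \<alpha>) = \<alpha>"
  using assms
  by (auto intro!: poly_mapping_eqI
      simp: map_key.rep_eq bij_is_inj bij_imp_bij_inv inv_f_f surj_f_inv_f bij_is_surj)

lemma is_symfun_zero: "is_symfun (\<lambda>_. 0)"
  by (simp add: is_symfun_def)

lemma is_symfun_one: "is_symfun (\<lambda>\<alpha>. if \<alpha> = 0 then 1 else (0::'a::zero_neq_one))"
proof -
  have z: "Poly_Mapping.map_key \<sigma> (0 :: nat \<Rightarrow>\<^sub>0 nat) = 0" if "bij \<sigma>" for \<sigma> :: "nat \<Rightarrow> nat"
    using that by (intro poly_mapping_eqI) (simp add: map_key.rep_eq bij_is_inj)
  have "(Poly_Mapping.map_key \<sigma> \<alpha> = 0) = (\<alpha> = 0)" if s: "bij \<sigma>" for \<sigma> :: "nat \<Rightarrow> nat" and \<alpha> :: "nat \<Rightarrow>\<^sub>0 nat"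
    using z[OF s] z[OF bij_imp_bij_inv[OF s]] map_key_inv(2)[OF s, of \<alpha>] by auto
  then show ?thesis
    by (auto simp: is_symfun_def intro!: exI[of _ 0] split: if_splits) (simp add: mdegree_def)
qed

lemma is_symfun_add:
  fixes f g :: "(nat \<Rightarrow>\<^sub>0 nat) \<Rightarrow> 'a::comm_ring_1"
  assumes "is_symfun f" "is_symfun g"
  shows "is_symfun (\<lambda>\<alpha>. f \<alpha> + g \<alpha>)"
proof -
  obtain d e where "\<forall>\<alpha>. f \<alpha> \<noteq> 0 \<longrightarrow> mdegree \<alpha> \<le> d" "\<forall>\<alpha>. g \<alpha> \<noteq> 0 \<longrightarrow> mdegree \<alpha> \<le> e"
    using assms by (auto simp: is_symfun_def)
  then have "\<forall>\<alpha>. f \<alpha> + g \<alpha> \<noteq> 0 \<longrightarrow> mdegree \<alpha> \<le> max d e"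
    by (metis add_0 le_max_iff_disj)
  then show ?thesis using assms by (auto simp: is_symfun_def)
qed

lemma is_symfun_scale:
  fixes f :: "(nat \<Rightarrow>\<^sub>0 nat) \<Rightarrow> 'a::comm_ring_1"
  assumes "is_symfun f"
  shows "is_symfun (\<lambda>\<alpha>. c * f \<alpha>)"
proof -
  obtain d where "\<forall>\<alpha>. f \<alpha> \<noteq> 0 \<longrightarrow> mdegree \<alpha> \<le> d"
    using assms by (auto simp: is_symfun_def)
  then have "\<forall>\<alpha>. c * f \<alpha> \<noteq> 0 \<longrightarrow> mdegree \<alpha> \<le> d"
    by (metis mult_zero_right)
  then show ?thesis using assms by (auto simp: is_symfun_def)
qed

lemma is_symfun_conv:
  fixes f g :: "(nat \<Rightarrow>\<^sub>0 nat) \<Rightarrow> 'a::comm_ring_1"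
  assumes f: "is_symfun f" and g: "is_symfun g"
  shows "is_symfun (conv f g)"
proof -
  obtain d e where d: "\<And>\<alpha>. f \<alpha> \<noteq> 0 \<Longrightarrow> mdegree \<alpha> \<le> d" and e: "\<And>\<alpha>. g \<alpha> \<noteq> 0 \<Longrightarrow> mdegree \<alpha> \<le> e"
    using assms by (auto simp: is_symfun_def)
  have "mdegree \<alpha> \<le> d + e" if nz: "conv f g \<alpha> \<noteq> 0" for \<alpha>
  proof -
    obtain \<beta> \<gamma> where "(\<beta>, \<gamma>) \<in> splits \<alpha>" "f \<beta> * g \<gamma> \<noteq> 0"
      using sum.not_neutral_contains_not_neutral[OF nz[unfolded conv_def]] by auto
    moreover from this have "f \<beta> \<noteq> 0" "g \<gamma> \<noteq> 0" by auto
    ultimately show ?thesis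
      using d[of \<beta>] e[of \<gamma>] by (auto simp: splits_def mdegree_add intro!: add_mono)
  qed
  moreover have "conv f g (Poly_Mapping.map_key \<sigma> \<alpha>) = conv f g \<alpha>" if s: "bij \<sigma>" for \<sigma> \<alpha>
  proof -
    have fs: "\<And>\<beta>. f (Poly_Mapping.map_key (inv \<sigma>) \<beta>) = f \<beta>"
      and gs: "\<And>\<beta>. g (Poly_Mapping.map_key (inv \<sigma>) \<beta>) = g \<beta>"
      using f g bij_imp_bij_inv[OF s] by (auto simp: is_symfun_def)
    have inj: "inj \<sigma>" "inj (inv \<sigma>)"
      using s by (auto simp: bij_is_inj bij_imp_bij_inv)
    have pl: "\<And>\<beta> \<gamma>. Poly_Mapping.map_key (inv \<sigma>) \<beta> + Poly_Mapping.map_key (inv \<sigma>) \<gamma>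
        = Poly_Mapping.map_key (inv \<sigma>) (\<beta> + \<gamma>)"
      by (simp add: map_key_plus inj)
    show ?thesis
      unfolding conv_def
      by (rule sum.reindex_bij_witness[of _
            "map_prod (Poly_Mapping.map_key \<sigma>) (Poly_Mapping.map_key \<sigma>)"
            "map_prod (Poly_Mapping.map_key (inv \<sigma>)) (Poly_Mapping.map_key (inv \<sigma>))"])
        (auto simp: splits_def map_key_inv[OF s] pl map_key_plus[OF inj(1), symmetric]
          fs gs)
  qed
  ultimately show ?thesis
    unfolding is_symfun_def by blast
qed

lemma conv_commute: "conv f g = conv g f"
proof
  show "conv f g \<alpha> = conv g f \<alpha>" for \<alpha>
    unfolding conv_def
    by (rule sum.reindex_bij_witness[of _ prod.swap prod.swap])
      (auto simp: splits_def add.commute mult.commute)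
qed

lemma conv_assoc: "conv (conv f g) h = conv f (conv g h)"
proof
  fix \<alpha>
  have "conv (conv f g) h \<alpha>
      = (\<Sum>p\<in>splits \<alpha>. \<Sum>r\<in>splits (fst p). f (fst r) * g (snd r) * h (snd p))"
    unfolding conv_def by (simp add: case_prod_unfold sum_distrib_right)
  also have "\<dots> = (\<Sum>(p, r)\<in>Sigma (splits \<alpha>) (\<lambda>p. splits (fst p)). f (fst r) * g (snd r) * h (snd p))"
    by (rule sum.Sigma) (simp_all add: finite_splits)
  also have "\<dots> = (\<Sum>(p, r)\<in>Sigma (splits \<alpha>) (\<lambda>p. splits (snd p)). f (fst p) * (g (fst r) * h (snd r)))"
    by (rule sum.reindex_bij_witness[of _
          "\<lambda>((a, bc), (b, c)). ((a + b, c), (a, b))" "\<lambda>((ab, c), (a, b)). ((a, b + c), (b, c))"])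
      (auto simp: splits_def add.assoc mult.assoc)
  also have "\<dots> = (\<Sum>p\<in>splits \<alpha>. \<Sum>r\<in>splits (snd p). f (fst p) * (g (fst r) * h (snd r)))"
    by (rule sum.Sigma[symmetric]) (simp_all add: finite_splits)
  also have "\<dots> = conv f (conv g h) \<alpha>"
    unfolding conv_def by (simp add: case_prod_unfold sum_distrib_left)
  finally show "conv (conv f g) h \<alpha> = conv f (conv g h) \<alpha>" .
qed

lemma conv_one: "conv (\<lambda>\<alpha>. if \<alpha> = 0 then 1 else 0) f = (f :: _ \<Rightarrow> 'a::comm_ring_1)"
proof
  fix \<alpha>
  have "conv (\<lambda>\<alpha>. if \<alpha> = 0 then 1 else 0) f \<alpha>
      = (\<Sum>p\<in>splits \<alpha>. if p = (0, \<alpha>) then f \<alpha> else 0)"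
  proof -
    have "(if b then 1 else 0) * x = (if b then x else 0)" for b and x :: 'a
      by simp
    then show ?thesis
      unfolding conv_def by (intro sum.cong) (auto simp only: splits_def split: if_splits, auto)
  qed
  also have "\<dots> = f \<alpha>"
    using finite_splits[of \<alpha>] by (simp add: splits_def)
  finally show "conv (\<lambda>\<alpha>. if \<alpha> = 0 then 1 else 0) f \<alpha> = f \<alpha>" .
qed

lemma conv_add: "conv (\<lambda>\<alpha>. f \<alpha> + g \<alpha>) h = (\<lambda>\<alpha>. conv f h \<alpha> + conv g h \<alpha>)"
  by (rule ext) (simp add: conv_def case_prod_unfold distrib_right sum.distrib)

instantiation symfun :: (comm_ring_1) comm_ring_1
begin

lift_definition zero_symfun :: "'a symfun" is "\<lambda>_. 0"
  by (rule is_symfun_zero)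

lift_definition one_symfun :: "'a symfun" is "\<lambda>\<alpha>. if \<alpha> = 0 then 1 else 0"
  by (rule is_symfun_one)

lift_definition plus_symfun :: "'a symfun \<Rightarrow> 'a symfun \<Rightarrow> 'a symfun" is "\<lambda>f g \<alpha>. f \<alpha> + g \<alpha>"
  by (rule is_symfun_add)

lift_definition uminus_symfun :: "'a symfun \<Rightarrow> 'a symfun" is "\<lambda>f \<alpha>. - f \<alpha>"
  by (simp add: is_symfun_def)

definition minus_symfun :: "'a symfun \<Rightarrow> 'a symfun \<Rightarrow> 'a symfun" where
  "minus_symfun f g = f + - g"

lift_definition times_symfun :: "'a symfun \<Rightarrow> 'a symfun \<Rightarrow> 'a symfun" is conv
  by (rule is_symfun_conv)

instance
proof
  fix a b c :: "'a symfun"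
  show "a + b + c = a + (b + c)" by transfer (simp add: add.assoc)
  show "a + b = b + a" by transfer (simp add: add.commute)
  show "0 + a = a" by transfer simp
  show "- a + a = 0" by transfer simp
  show "a - b = a + - b" by (rule minus_symfun_def)
  show "a * b * c = a * (b * c)" by transfer (rule conv_assoc)
  show "a * b = b * a" by transfer (rule conv_commute)
  show "1 * a = a" by transfer (rule conv_one)
  show "(a + b) * c = a * c + b * c" by transfer (rule conv_add)
  show "(0::'a symfun) \<noteq> 1" by transfer (metis zero_neq_one)
qed

end

lift_definition sscale :: "'a::comm_ring_1 \<Rightarrow> 'a symfun \<Rightarrow> 'a symfun" is "\<lambda>c f \<alpha>. c * f \<alpha>"
  by (rule is_symfun_scale)

definition exponents :: "(nat \<Rightarrow>\<^sub>0 nat) \<Rightarrow> nat multiset" where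
  "exponents \<alpha> = image_mset (Poly_Mapping.lookup \<alpha>) (mset_set (Poly_Mapping.keys \<alpha>))"

lemma mdegree_exponents: "mdegree \<alpha> = sum_mset (exponents \<alpha>)"
  by (simp add: mdegree_def exponents_def sum_unfold_sum_mset)

lemma exponents_map_key:
  assumes "bij \<sigma>"
  shows "exponents (Poly_Mapping.map_key \<sigma> \<alpha>) = exponents \<alpha>"
proof -
  let ?K = "Poly_Mapping.keys (Poly_Mapping.map_key \<sigma> \<alpha>)"
  have inj: "inj \<sigma>" and surj: "surj \<sigma>"
    using assms by (auto simp: bij_is_inj bij_is_surj)
  have K: "\<sigma> ` ?K = Poly_Mapping.keys \<alpha>"
    using inj surj by (simp add: keys_map_key)
  have "exponents \<alpha> = image_mset (Poly_Mapping.lookup \<alpha>) (image_mset \<sigma> (mset_set ?K))"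
    using inj by (simp add: exponents_def K[symmetric] image_mset_mset_set inj_on_def)
  also have "\<dots> = exponents (Poly_Mapping.map_key \<sigma> \<alpha>)"
    using inj by (simp add: exponents_def multiset.map_comp map_key.rep_eq comp_def)
  finally show ?thesis by simp
qed

lift_definition monomial_sym :: "nat list \<Rightarrow> 'a::comm_ring_1 symfun" is
  "\<lambda>\<nu> \<alpha>. if exponents \<alpha> = mset \<nu> then 1 else 0"
  by (auto simp: is_symfun_def exponents_map_key mdegree_exponents)

text \<open>\<open>p\<^sub>k = x\<^sub>0\<^sup>k + x\<^sub>1\<^sup>k + \<dots>\<close>; only meaningful for \<open>k > 0\<close>.\<close>

lift_definition power_sum :: "nat \<Rightarrow> 'a::comm_ring_1 symfun" is
  "\<lambda>k \<alpha>. if \<exists>i. \<alpha> = Poly_Mapping.single i k then 1 else 0"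
proof -
  fix k
  have sym: "\<exists>i. Poly_Mapping.map_key \<sigma> \<alpha> = Poly_Mapping.single i k"
    if s: "bij \<sigma>" and a: "\<exists>i. \<alpha> = Poly_Mapping.single i k" for \<sigma> :: "nat \<Rightarrow> nat" and \<alpha> :: "nat \<Rightarrow>\<^sub>0 nat"
  proof -
    obtain i where i: "\<alpha> = Poly_Mapping.single i k" using a by blast
    obtain j where j: "\<sigma> j = i" using s by (metis bij_pointE)
    have "Poly_Mapping.map_key \<sigma> \<alpha> = Poly_Mapping.single j k"
      using s unfolding i j[symmetric] by (simp add: map_key_single bij_is_inj)
    then show ?thesis ..
  qed
  have "(\<exists>i. Poly_Mapping.map_key \<sigma> \<alpha> = Poly_Mapping.single i k)
      = (\<exists>i. \<alpha> = Poly_Mapping.single i k)" if s: "bij \<sigma>" for \<sigma> :: "nat \<Rightarrow> nat" and \<alpha> :: "nat \<Rightarrow>\<^sub>0 nat"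
    using sym[OF s, of \<alpha>] sym[OF bij_imp_bij_inv[OF s], of "Poly_Mapping.map_key \<sigma> \<alpha>"]
    by (auto simp: map_key_inv[OF s])
  moreover have "mdegree (Poly_Mapping.single i k) \<le> k" for i
    by (simp add: mdegree_def)
  ultimately show "is_symfun (\<lambda>\<alpha>. if \<exists>i. \<alpha> = Poly_Mapping.single i k then 1 else (0::'a))"
    unfolding is_symfun_def by (auto intro!: exI[of _ k])
qed

definition algebra_hom :: "('a::comm_ring_1 symfun \<Rightarrow> 'a symfun) \<Rightarrow> bool" where
  "algebra_hom \<Phi> \<longleftrightarrow>
     \<Phi> 1 = 1 \<and>
     (\<forall>f g. \<Phi> (f + g) = \<Phi> f + \<Phi> g) \<and>
     (\<forall>f g. \<Phi> (f * g) = \<Phi> f * \<Phi> g) \<and>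
     (\<forall>c f. \<Phi> (sscale c f) = sscale c (\<Phi> f))"


section \<open>The ground field \<open>\<rat>(q)\<close>\<close>

type_synonym qfield = "rat poly fract"

definition q :: qfield where
  "q = Fract [:0, 1:] 1"

text \<open>
  \<open>is_plethysm \<Phi>\<close> says that \<open>\<Phi> f = f[X / (1 - q\<^sup>-\<^sup>1)]\<close>.  Since \<open>\<rat>(q)\<close> has characteristic 0, the power
  sums are algebraically independent generators of the ring of symmetric functions over \<open>\<rat>(q)\<close>,
  so there is exactly one such \<open>\<Phi>\<close>.  Since \<open>p\<^sub>1 = m\<^sub>1\<close> is sent to \<open>m\<^sub>1 / (1 - q\<^sup>-\<^sup>1)\<close>, the coefficient
  of \<open>m\<^sub>\<pi>\<close> in \<open>m\<^sub>\<nu>[X / (1 - q\<^sup>-\<^sup>1)]\<close> has a pole of order \<open>\<ell>(\<nu>)\<close> at \<open>q = 1\<close> for \<open>\<pi> = \<nu>\<close>; a formula for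
  it needs a factor \<open>(1 - q\<^sup>-\<^sup>1)\<^sup>-\<^sup>\<ell>\<^sup>(\<^sup>\<nu>\<^sup>)\<close>, equivalently \<open>q\<^sup>n / (q - 1)\<^sup>\<ell>\<^sup>(\<^sup>\<nu>\<^sup>)\<close> in place of \<open>q\<^sup>n\<^sup>-\<^sup>\<ell>\<^sup>(\<^sup>\<nu>\<^sup>)\<close>.
\<close>

definition is_plethysm :: "(qfield symfun \<Rightarrow> qfield symfun) \<Rightarrow> bool" where
  "is_plethysm \<Phi> \<longleftrightarrow>
     algebra_hom \<Phi> \<and>
     (\<forall>k>0. \<Phi> (power_sum k) = sscale (1 / (1 - inverse q ^ k)) (power_sum k))"

definition qint :: "nat \<Rightarrow> qfield" where
  "qint k = (\<Sum>i<k. q ^ i)"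

definition qfact :: "nat \<Rightarrow> qfield" where
  "qfact k = (\<Prod>i=1..k. qint i)"

definition qfact_part :: "nat list \<Rightarrow> qfield" where
  "qfact_part \<pi> = prod_list (map qfact \<pi>)"


section \<open>The symmetric group\<close>

definition Sym :: "nat \<Rightarrow> (nat \<Rightarrow> nat) set" where
  "Sym n = {w. w permutes {1..n}}"

abbreviation simple_refl :: "nat \<Rightarrow> nat \<Rightarrow> nat" where
  "simple_refl i \<equiv> transpose i (Suc i)"

definition len :: "nat \<Rightarrow> (nat \<Rightarrow> nat) \<Rightarrow> nat" where
  "len n w = card {(i, j). 1 \<le> i \<and> i < j \<and> j \<le> n \<and> w j < w i}"

definition cycle_type :: "nat \<Rightarrow> (nat \<Rightarrow> nat) \<Rightarrow> nat list" where
  "cycle_type n w = rev (sorted_list_of_multiset (image_mset card (mset_set (orbit w ` {1..n}))))"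

definition conj_class :: "nat \<Rightarrow> nat list \<Rightarrow> (nat \<Rightarrow> nat) set" where
  "conj_class n \<mu> = {w \<in> Sym n. cycle_type n w = \<mu>}"

definition min_length :: "nat \<Rightarrow> nat list \<Rightarrow> (nat \<Rightarrow> nat) \<Rightarrow> bool" where
  "min_length n \<mu> \<gamma> \<longleftrightarrow> \<gamma> \<in> conj_class n \<mu> \<and> (\<forall>w\<in>conj_class n \<mu>. len n \<gamma> \<le> len n w)"

definition is_expansion_matrix :: "nat \<Rightarrow> (nat list \<Rightarrow> (nat \<Rightarrow> nat) \<Rightarrow> qfield) \<Rightarrow> bool" where
  "is_expansion_matrix n \<kappa> \<longleftrightarrow>
     (\<forall>\<nu>\<in>partitions n.
       (\<forall>\<mu>\<in>partitions n. \<forall>\<gamma>. min_length n \<mu> \<gamma> \<longrightarrow> \<kappa> \<nu> \<gamma> = (if \<mu> = \<nu> then 1 else 0)) \<and>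
       (\<forall>w\<in>Sym n. \<forall>i\<in>{1..<n}. let s = simple_refl i in
          (len n (s \<circ> w) = len n (w \<circ> s) \<and> len n (s \<circ> w) = len n w + 1
             \<longrightarrow> \<kappa> \<nu> (s \<circ> w) = \<kappa> \<nu> (w \<circ> s)) \<and>
          (len n (s \<circ> w \<circ> s) = len n w + 2
             \<longrightarrow> \<kappa> \<nu> (s \<circ> w \<circ> s) = q * \<kappa> \<nu> w + (q - 1) * \<kappa> \<nu> (w \<circ> s))))"

text \<open>The \<open>j\<close>-th block (counted from 0) is \<open>{\<pi>\<^sub>1 + \<dots> + \<pi>\<^sub>j + 1, \<dots>, \<pi>\<^sub>1 + \<dots> + \<pi>\<^sub>j\<^sub>+\<^sub>1}\<close>.\<close>

definition block :: "nat list \<Rightarrow> nat \<Rightarrow> nat set" where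
  "block \<pi> j = {sum_list (take j \<pi>)<..sum_list (take (Suc j) \<pi>)}"

definition young_subgroup :: "nat list \<Rightarrow> (nat \<Rightarrow> nat) set" where
  "young_subgroup \<pi> = {w \<in> Sym (sum_list \<pi>). \<forall>j<length \<pi>. w ` block \<pi> j = block \<pi> j}"

definition contraction :: "(nat \<Rightarrow> nat) \<Rightarrow> nat list \<Rightarrow> qfield" where
  "contraction w \<pi> = (if w \<in> young_subgroup \<pi> then 1 else 0)"

end

theory Submission
  imports Defs
begin

text \<open>
  Put \<open>t = q\<^sup>-\<^sup>1\<close>.  Up to powers of \<open>q\<close> and \<open>q - 1\<close>, both sides of the formula are sums over the ways to distribute the parts of \<open>\<nu>\<close>
  over the parts of \<open>\<pi>\<close>, each part \<open>\<pi>\<^sub>i\<close> contributing the principal specialisation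
  \<open>m\<^sub>\<mu>[1 / (1 - t)] = m\<^sub>\<mu>(1, t, t\<^sup>2, \<dots>)\<close> of the parts \<open>\<mu>\<close> that it receives.  These specialisations obey
  a recursion that splits off one part, and the functionals \<open>spec\<close> (one part of \<open>\<pi>\<close>) and \<open>pspec\<close> (all
  parts) are defined by it.

  On the side of symmetric functions, \<open>\<Phi>\<close> is determined by its values on the power sums.  Concretely,
  the expansion of \<open>p\<^sub>k m\<^sub>\<nu>\<close> in monomial symmetric functions has exactly one term with more parts than
  \<open>\<nu>\<close>, which turns the homomorphism property into a recursion for the coefficients of \<open>\<Phi>(m\<^sub>\<nu>)\<close>.  The
  numbers given by \<open>pspec\<close> satisfy the same recursion (\<open>pspec_lower\<close>), whence
  \<open>mcoeff_plethysm_msym\<close>.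

  On the side of the symmetric group, the conditions on \<open>\<kappa>\<close> make \<open>T\<^sub>w \<mapsto> \<kappa>\<^sub>\<nu>\<^sub>,\<^sub>w\<close> a trace on the Hecke
  algebra.  Let \<open>E\<^sub>n = \<Sum> T\<^sub>w / [n]!\<close>, summed over \<open>S\<^sub>n\<close>, and let \<open>\<gamma>\<^sub>k\<close> be a Coxeter element of \<open>S\<^sub>k\<close>.
  Decompose \<open>S\<^sub>n\<close> into cosets of \<open>S\<^sub>n\<^sub>-\<^sub>1\<close>, whose representatives are \<open>s\<^sub>n\<^sub>-\<^sub>1 s\<^sub>n\<^sub>-\<^sub>2 \<dots> s\<^sub>j\<close>.  Because
  \<open>\<Sum> T\<^sub>w\<close> over \<open>S\<^sub>n\<^sub>-\<^sub>1\<close> absorbs \<open>T\<^sub>s\<close> into a factor \<open>q\<close>, all factors of a representative other than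
  \<open>s\<^sub>n\<^sub>-\<^sub>1\<close> can be moved around the trace and replaced by \<open>q\<close>.  Iteration gives
  \<open>[n] E\<^sub>n = \<Sum> E\<^sub>n\<^sub>-\<^sub>k \<gamma>\<^sub>k\<close>, summed over \<open>1 \<le> k \<le> n\<close>, under every trace (\<open>young_sum_peel\<close>), which is the
  recursion for principal specialisations again.  Applied to one block of the Young subgroup after
  another, it rewrites the sum of \<open>\<kappa>\<^sub>\<nu>\<^sub>,\<^sub>w\<close> over \<open>W\<^sub>\<pi>\<close> in terms of Coxeter elements of Young subgroups
  (\<open>young_sum_eq_pspec\<close>).  These have minimal length in their conjugacy classes (\<open>min_length_coxeter\<close>),
  so \<open>\<kappa>\<^sub>\<nu>\<close> takes the value 1 or 0 on them.  The Hecke algebra itself does not appear below: the two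
  relations on \<open>\<kappa>\<close> suffice to move a simple reflection around the trace (\<open>expansion_shift\<close>).
\<close>

section \<open>The ground field\<close>

text \<open>
  The field of fractions of \<open>\<rat>[q]\<close> has characteristic zero, and no positive power of \<open>q\<close> equals 1.
  All divisions below rest on these two facts.
\<close>

lemma q_power: "q ^ m = Fract ([:0, 1:] ^ m) 1"
  by (induction m) (simp_all add: q_def One_fract_def)

lemma q_nonzero [simp]: "q \<noteq> 0"
  by (simp add: q_def Zero_fract_def eq_fract)

lemma q_power_eq_1_iff [simp]: "q ^ m = 1 \<longleftrightarrow> m = 0"
proof -
  have "m = 0" if "[:0, 1::rat:] ^ m = 1"
    using arg_cong[OF that, of degree] by (simp add: degree_power_eq)
  then show ?thesis
    by (auto simp: q_power One_fract_def eq_fract)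
qed

lemma q_neq_1 [simp]: "q \<noteq> 1"
  using q_power_eq_1_iff[of 1] by simp

lemma of_nat_qfield: "(of_nat m :: qfield) = Fract (of_nat m) 1"
  by (induction m) (simp_all add: Zero_fract_def One_fract_def)

lemma of_nat_qfield_eq_0_iff [simp]: "(of_nat m :: qfield) = 0 \<longleftrightarrow> m = 0"
  by (simp add: of_nat_qfield Zero_fract_def eq_fract)

lemma two_qfield [simp]: "(2 :: qfield) \<noteq> 0"
  using of_nat_qfield_eq_0_iff[of 2] by (simp del: of_nat_qfield_eq_0_iff)

lemma qint_altdef: "qint m = (q ^ m - 1) / (q - 1)"
  by (induction m) (simp_all add: qint_def field_simps)

lemma qfact_Suc: "qfact (Suc m) = qint (Suc m) * qfact m"
  by (simp add: qfact_def prod.nat_ivl_Suc' mult.commute)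

lemma qfact_nonzero [simp]: "qfact m \<noteq> 0"
proof (induction m)
  case (Suc m)
  then show ?case
    by (simp add: qfact_Suc qint_altdef del: power_Suc)
qed (simp add: qfact_def)

lemma qfact_part_nonzero [simp]: "qfact_part \<pi> \<noteq> 0"
  by (induction \<pi>) (simp_all add: qfact_part_def)


section \<open>Pairing with principal specialisations\<close>

text \<open>
  \<open>spec n \<psi>\<close> is the sum of \<open>m\<^sub>\<mu>[1 / (1 - t)] \<psi> \<mu>\<close> over the partitions \<open>\<mu>\<close> of \<open>n\<close>, with \<open>t = q\<^sup>-\<^sup>1\<close> and
  \<open>\<mu>\<close> read as a multiset of parts.  It is defined by a recursion because only the recursion is ever
  used: sorting the terms of \<open>m\<^sub>\<mu>(1, t, t\<^sup>2, \<dots>)\<close> by the part \<open>a\<close> that sits on the smallest occurring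
  power of \<open>t\<close> leaves the specialisation of the remaining parts and a geometric series with value
  \<open>1 / (1 - t\<^sup>n)\<close>, up to powers of \<open>t\<close>.  Working with functionals of \<open>\<psi>\<close> instead of the numbers
  \<open>m\<^sub>\<mu>[1 / (1 - t)]\<close> keeps the multiplicities of parts out of the recursion.
\<close>

function spec :: "nat \<Rightarrow> (nat multiset \<Rightarrow> qfield) \<Rightarrow> qfield" where
  "spec n \<psi> =
     (if n = 0 then \<psi> {#}
      else (\<Sum>a=1..n. q ^ a * spec (n - a) (\<lambda>A. \<psi> (add_mset a A))) / (q ^ n - 1))"
  by auto
termination
  by (relation "measure fst") auto

declare spec.simps [simp del]

lemma spec_0 [simp]: "spec 0 \<psi> = \<psi> {#}"
  by (simp add: spec.simps)

lemma spec_rec: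
  "(q ^ n - 1) * spec n \<psi> = (\<Sum>a=1..n. q ^ a * spec (n - a) (\<lambda>A. \<psi> (add_mset a A)))"
  by (cases "n = 0") (simp_all add: spec.simps[of n])

lemma spec_sum: "spec n (\<lambda>A. \<Sum>i\<in>I. f i A) = (\<Sum>i\<in>I. spec n (f i))"
proof (induction n arbitrary: f rule: less_induct)
  case (less n)
  show ?case
  proof (cases "n = 0")
    case False
    have "(\<Sum>a=1..n. q ^ a * spec (n - a) (\<lambda>A. \<Sum>i\<in>I. f i (add_mset a A)))
        = (\<Sum>a=1..n. q ^ a * (\<Sum>i\<in>I. spec (n - a) (\<lambda>A. f i (add_mset a A))))"
      by (intro sum.cong refl) (subst less.IH, auto)
    also have "\<dots> = (\<Sum>i\<in>I. \<Sum>a=1..n. q ^ a * spec (n - a) (\<lambda>A. f i (add_mset a A)))"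
      unfolding sum_distrib_left by (rule sum.swap)
    finally show ?thesis
      using False by (simp add: spec.simps[of n] sum_divide_distrib)
  qed simp
qed

lemma spec_add: "spec n (\<lambda>A. f A + g A) = spec n f + spec n g"
  using spec_sum[where I = UNIV and f = "\<lambda>b. if b then f else g"] by (simp add: UNIV_bool add.commute)

lemma spec_scale: "spec n (\<lambda>A. c * f A) = c * spec n f"
proof (induction n arbitrary: f rule: less_induct)
  case (less n)
  show ?case
  proof (cases "n = 0")
    case False
    have "(\<Sum>a=1..n. q ^ a * spec (n - a) (\<lambda>A. c * f (add_mset a A)))
        = c * (\<Sum>a=1..n. q ^ a * spec (n - a) (\<lambda>A. f (add_mset a A)))"
      unfolding sum_distrib_left by (intro sum.cong refl) (subst less.IH, auto simp: mult_ac)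
    then show ?thesis
      using False by (simp add: spec.simps[of n])
  qed simp
qed

text \<open>
  Since \<open>m\<^sub>\<mu>[X + Y]\<close> is the sum of \<open>m\<^sub>\<alpha>[X] m\<^sub>\<beta>[Y]\<close> over the splittings of the multiset \<open>\<mu>\<close> into \<open>\<alpha>\<close>
  and \<open>\<beta>\<close>, the coefficient of \<open>x\<^sup>b\<close> in \<open>m\<^sub>\<mu>[X / (1 - t)]\<close> should distribute the parts of \<open>\<mu>\<close> over
  the entries of \<open>b\<close> and take one principal specialisation for each entry.  \<open>pspec b \<phi>\<close> is the sum of
  these candidate coefficients against \<open>\<phi>\<close>.  That they are the true coefficients is
  \<open>mcoeff_plethysm_msym\<close>.
\<close>

primrec pspec :: "nat list \<Rightarrow> (nat multiset \<Rightarrow> qfield) \<Rightarrow> qfield" where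
  "pspec [] \<phi> = \<phi> {#}"
| "pspec (n # b) \<phi> = spec n (\<lambda>A. pspec b (\<lambda>B. \<phi> (A + B)))"

lemma pspec_sum: "pspec b (\<lambda>A. \<Sum>i\<in>I. f i A) = (\<Sum>i\<in>I. pspec b (f i))"
  by (induction b arbitrary: f) (simp_all add: spec_sum)

lemma pspec_add: "pspec b (\<lambda>A. f A + g A) = pspec b f + pspec b g"
  by (induction b arbitrary: f g) (simp_all add: spec_add)

lemma pspec_scale: "pspec b (\<lambda>A. c * f A) = c * pspec b f"
  by (induction b arbitrary: f) (simp_all add: spec_scale)

text \<open>
  Multiplication by the power sum \<open>p\<^sub>k\<close>, seen from the coefficients: in \<open>p\<^sub>k F\<close>, a monomial has as its
  coefficient the sum of the coefficients in \<open>F\<close> of the monomials that arise if \<open>x\<^sub>i\<^sup>k\<close> is divided out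
  for some \<open>i\<close>.  An exponent that becomes zero disappears from the multiset.
\<close>

definition lower :: "nat \<Rightarrow> (nat multiset \<Rightarrow> qfield) \<Rightarrow> nat multiset \<Rightarrow> qfield" where
  "lower k \<phi> M =
     (\<Sum>j\<in>#M. if k \<le> j then \<phi> (M - {#j#} + (if j = k then {#} else {#j - k#})) else 0)"

lemma lower_empty [simp]: "lower k \<phi> {#} = 0"
  by (simp add: lower_def)

text \<open>
  Lowering one exponent of a disjoint union happens on one of the two sides, so \<open>lower k\<close> is a
  derivation.  This is what lets \<open>pspec_lower\<close> reduce to a single entry.
\<close>

lemma lower_union:
  "lower k \<phi> (A + B) = lower k (\<lambda>A. \<phi> (A + B)) A + lower k (\<lambda>B. \<phi> (A + B)) B"
proof -
  have 1: "(\<Sum>j\<in>#A. if k \<le> j then \<phi> (A + B - {#j#} + (if j = k then {#} else {#j - k#})) else 0)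
      = lower k (\<lambda>A. \<phi> (A + B)) A"
    unfolding lower_def by (intro arg_cong[where f = sum_mset] image_mset_cong)
      (auto simp: ac_simps)
  have 2: "(\<Sum>j\<in>#B. if k \<le> j then \<phi> (A + B - {#j#} + (if j = k then {#} else {#j - k#})) else 0)
      = lower k (\<lambda>B. \<phi> (A + B)) B"
    unfolding lower_def by (intro arg_cong[where f = sum_mset] image_mset_cong)
      (auto simp: ac_simps)
  show ?thesis
    unfolding 1[symmetric] 2[symmetric] by (simp add: lower_def)
qed

lemma lower_add_mset:
  "lower k \<phi> (add_mset a A) =
     (if k \<le> a then \<phi> (A + (if a = k then {#} else {#a - k#})) else 0)
     + lower k (\<lambda>A. \<phi> (add_mset a A)) A"
  using lower_union[of k \<phi> "{#a#}" A] by (simp add: lower_def add.commute)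

lemma sum_shift_ge:
  fixes f :: "nat \<Rightarrow> qfield"
  shows "(\<Sum>a=1..n. if k < a then f a else 0) = (\<Sum>a=1..n - k. f (a + k))"
proof -
  have "(\<Sum>a=1..n. if k < a then f a else 0) = (\<Sum>a\<in>{a\<in>{1..n}. k < a}. f a)"
    by (rule sum.inter_filter[symmetric]) simp
  also have "\<dots> = (\<Sum>a=1..n - k. f (a + k))"
    by (rule sum.reindex_bij_witness[of _ "\<lambda>a. a + k" "\<lambda>a. a - k"]) auto
  finally show ?thesis .
qed

text \<open>
  The dual form of \<open>p\<^sub>k[1 / (1 - t)] = 1 / (1 - t\<^sup>k) = q\<^sup>k / (q\<^sup>k - 1)\<close> and of the multiplicativity of the
  specialisation.  In the recursion for \<open>spec n\<close>, the part \<open>a\<close> that is split off disappears by the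
  lowering, or is lowered to \<open>a - k\<close>, or is not the lowered part.  Summed over \<open>a\<close>, each case gives a multiple of \<open>spec (n - k) \<psi>\<close> if
  \<open>k \<le> n\<close>, and with \<open>m = n - k\<close> and \<open>h = q\<^sup>k / (q\<^sup>k - 1)\<close> the three factors add up by
  \<open>q\<^sup>k + q\<^sup>k (q\<^sup>m - 1) + h (q\<^sup>m - 1) = h (q\<^sup>n - 1)\<close>.
\<close>

lemma spec_lower:
  assumes k: "k > 0"
  shows "spec n (lower k \<psi>) = (if k \<le> n then q ^ k / (q ^ k - 1) * spec (n - k) \<psi> else 0)"
proof (induction n arbitrary: \<psi> rule: less_induct)
  case (less n)
  show ?case
  proof (cases "n = 0")
    case True
    then show ?thesis using k by simp
  next
    case False
    define h where "h = q ^ k / (q ^ k - 1)"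
    have k1: "q ^ k \<noteq> 1" using k by simp
    have n1: "q ^ n \<noteq> 1" using False by simp
    have split: "spec (n - a) (\<lambda>A. lower k \<psi> (add_mset a A)) =
        (if a = k then spec (n - k) \<psi> else 0)
        + (if k < a then spec (n - a) (\<lambda>A. \<psi> (add_mset (a - k) A)) else 0)
        + (if k \<le> n - a then h * spec (n - a - k) (\<lambda>A. \<psi> (add_mset a A)) else 0)"
      if a: "a \<in> {1..n}" for a
    proof -
      have "spec (n - a) (\<lambda>A. lower k \<psi> (add_mset a A)) =
          spec (n - a) (\<lambda>A. if k \<le> a then \<psi> (A + (if a = k then {#} else {#a - k#})) else 0)
          + spec (n - a) (lower k (\<lambda>A. \<psi> (add_mset a A)))"
        unfolding lower_add_mset spec_add ..
      also have "spec (n - a) (lower k (\<lambda>A. \<psi> (add_mset a A))) =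
          (if k \<le> n - a then h * spec (n - a - k) (\<lambda>A. \<psi> (add_mset a A)) else 0)"
        unfolding h_def by (rule less.IH) (use a in auto)
      also have "spec (n - a) (\<lambda>A. if k \<le> a then \<psi> (A + (if a = k then {#} else {#a - k#})) else 0)
         = (if a = k then spec (n - k) \<psi> else 0)
           + (if k < a then spec (n - a) (\<lambda>A. \<psi> (add_mset (a - k) A)) else 0)"
        using spec_scale[of "n - a" 0 \<psi>] by auto
      finally show ?thesis .
    qed
    have "(q ^ n - 1) * spec n (lower k \<psi>) =
        (\<Sum>a=1..n. q ^ a * spec (n - a) (\<lambda>A. lower k \<psi> (add_mset a A)))"
      by (rule spec_rec)
    also have "\<dots> =
        (\<Sum>a=1..n. if a = k then q ^ k * spec (n - k) \<psi> else 0)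
        + (\<Sum>a=1..n. if k < a then q ^ a * spec (n - a) (\<lambda>A. \<psi> (add_mset (a - k) A)) else 0)
        + (\<Sum>a=1..n. if k \<le> n - a then q ^ a * (h * spec (n - a - k) (\<lambda>A. \<psi> (add_mset a A))) else 0)"
      unfolding sum.distrib[symmetric]
      by (intro sum.cong refl) (simp add: split algebra_simps)
    also have "(\<Sum>a=1..n. if a = k then q ^ k * spec (n - k) \<psi> else 0)
        = (if k \<le> n then q ^ k * spec (n - k) \<psi> else 0)"
      using k by (simp add: Suc_le_eq)
    also have "(\<Sum>a=1..n. if k < a then q ^ a * spec (n - a) (\<lambda>A. \<psi> (add_mset (a - k) A)) else 0)
        = (\<Sum>a=1..n - k. q ^ (a + k) * spec (n - k - a) (\<lambda>A. \<psi> (add_mset a A)))"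
      unfolding sum_shift_ge by (intro sum.cong refl) (simp add: add.commute)
    also have "\<dots> = q ^ k * ((q ^ (n - k) - 1) * spec (n - k) \<psi>)"
      unfolding spec_rec sum_distrib_left by (simp add: power_add mult_ac)
    also have "(\<Sum>a=1..n. if k \<le> n - a
          then q ^ a * (h * spec (n - a - k) (\<lambda>A. \<psi> (add_mset a A))) else 0)
        = (\<Sum>a\<in>{a\<in>{1..n}. k \<le> n - a}. h * (q ^ a * spec (n - k - a) (\<lambda>A. \<psi> (add_mset a A))))"
      unfolding sum.inter_filter[OF finite_atLeastAtMost]
      by (intro sum.cong refl) (simp add: mult_ac add.commute)
    also have "{a\<in>{1..n}. k \<le> n - a} = {1..n - k}"
      using k by auto
    also have "(\<Sum>a\<in>{1..n - k}. h * (q ^ a * spec (n - k - a) (\<lambda>A. \<psi> (add_mset a A))))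
        = h * ((q ^ (n - k) - 1) * spec (n - k) \<psi>)"
      unfolding spec_rec sum_distrib_left ..
    finally have eq: "(q ^ n - 1) * spec n (lower k \<psi>) =
        (if k \<le> n then q ^ k * spec (n - k) \<psi> else 0)
        + q ^ k * ((q ^ (n - k) - 1) * spec (n - k) \<psi>) + h * ((q ^ (n - k) - 1) * spec (n - k) \<psi>)" .
    show ?thesis
    proof (cases "k \<le> n")
      case False
      then show ?thesis using eq n1 by simp
    next
      case True
      define m where "m = n - k"
      have n: "n = k + m" using True by (simp add: m_def)
      have "q ^ k + q ^ k * (q ^ m - 1) + h * (q ^ m - 1) = h * (q ^ n - 1)"
        using k1 by (simp add: h_def n power_add field_simps)
      moreover have "(q ^ n - 1) * spec n (lower k \<psi>) =
          (q ^ k + q ^ k * (q ^ m - 1) + h * (q ^ m - 1)) * spec m \<psi>"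
        unfolding eq using True by (simp add: algebra_simps flip: m_def)
      ultimately have "(q ^ n - 1) * spec n (lower k \<psi>) = (q ^ n - 1) * (h * spec (n - k) \<psi>)"
        by (simp add: m_def)
      then have "spec n (lower k \<psi>) = h * spec (n - k) \<psi>"
        unfolding mult_cancel_left using n1 by simp
      then show ?thesis
        using True by (simp add: h_def)
    qed
  qed
qed

lemma pspec_lower:
  assumes k: "k > 0"
  shows "pspec b (lower k \<phi>) =
    q ^ k / (q ^ k - 1) * (\<Sum>i<length b. if k \<le> b ! i then pspec (b[i := b ! i - k]) \<phi> else 0)"
proof (induction b arbitrary: \<phi>)
  case (Cons n b)
  have "pspec (n # b) (lower k \<phi>) =
      spec n (\<lambda>A. pspec b (\<lambda>B. lower k (\<lambda>A. \<phi> (A + B)) A))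
      + spec n (\<lambda>A. pspec b (lower k (\<lambda>B. \<phi> (A + B))))"
    by (simp add: lower_union pspec_add spec_add)
  also have "(\<lambda>A. pspec b (\<lambda>B. lower k (\<lambda>A. \<phi> (A + B)) A)) = lower k (\<lambda>A. pspec b (\<lambda>B. \<phi> (A + B)))"
  proof
    fix A
    have "pspec b (\<lambda>B. \<Sum>j\<in>#C. if k \<le> j then \<phi> (A - {#j#} + (if j = k then {#} else {#j - k#}) + B) else 0)
      = (\<Sum>j\<in>#C. if k \<le> j then pspec b (\<lambda>B. \<phi> (A - {#j#} + (if j = k then {#} else {#j - k#}) + B)) else 0)"
      for C
    proof (induction C)
      case empty
      show ?case using pspec_scale[of b 0 "\<lambda>_. 0"] by simp
    next
      case (add c C)
      show ?case using pspec_scale[of b 0 "\<lambda>_. 0"] by (simp add: pspec_add add.IH)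
    qed
    then show "pspec b (\<lambda>B. lower k (\<lambda>A. \<phi> (A + B)) A) = lower k (\<lambda>A. pspec b (\<lambda>B. \<phi> (A + B))) A"
      by (simp add: lower_def)
  qed
  also have "spec n \<dots> = (if k \<le> n then q ^ k / (q ^ k - 1) * pspec ((n - k) # b) \<phi> else 0)"
    by (simp add: spec_lower[OF k])
  also have "spec n (\<lambda>A. pspec b (lower k (\<lambda>B. \<phi> (A + B)))) =
      q ^ k / (q ^ k - 1) * (\<Sum>i<length b. if k \<le> b ! i then pspec (n # b[i := b ! i - k]) \<phi> else 0)"
  proof -
    have "spec n (\<lambda>A. \<Sum>i<length b. if k \<le> b ! i then pspec (b[i := b ! i - k]) (\<lambda>B. \<phi> (A + B)) else 0)
       = (\<Sum>i<length b. if k \<le> b ! i then pspec (n # b[i := b ! i - k]) \<phi> else 0)"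
      unfolding spec_sum
      using spec_scale[of n 0 "\<lambda>_. 0"] by (intro sum.cong refl) simp
    then show ?thesis
      by (simp only: Cons.IH spec_scale)
  qed
  finally show ?case
    by (simp add: sum.lessThan_Suc_shift distrib_left cong: if_cong del: sum.lessThan_Suc)
qed simp

section \<open>Products with power sums\<close>

lemma splits_single:
  "{(\<beta>, \<gamma>) \<in> splits \<alpha>. \<exists>i. \<beta> = Poly_Mapping.single i k} =
     (\<lambda>i. (Poly_Mapping.single i k, \<alpha> - Poly_Mapping.single i k)) ` {i. k \<le> Poly_Mapping.lookup \<alpha> i}"
proof -
  have le: "k \<le> Poly_Mapping.lookup (Poly_Mapping.single i k + \<gamma>) i" for i and \<gamma> :: "nat \<Rightarrow>\<^sub>0 nat"
    by (simp add: lookup_add)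
  have "Poly_Mapping.single i k + (\<alpha> - Poly_Mapping.single i k) = \<alpha>"
    if "k \<le> Poly_Mapping.lookup \<alpha> i" for i
    using that by (intro poly_mapping_eqI) (auto simp: lookup_add lookup_minus lookup_single when_def)
  then show ?thesis
    using le by (auto simp: splits_def image_iff)
qed

lemma mcoeff_power_sum_mult:
  fixes F :: "'a::comm_ring_1 symfun"
  assumes k: "k > 0"
  shows "mcoeff (power_sum k * F) \<alpha> =
    (\<Sum>i | k \<le> Poly_Mapping.lookup \<alpha> i. mcoeff F (\<alpha> - Poly_Mapping.single i k))"
proof -
  have inj: "inj_on (\<lambda>i. (Poly_Mapping.single i k, \<alpha> - Poly_Mapping.single i k)) A" for A
  proof (rule inj_onI)
    fix i j assume "(Poly_Mapping.single i k, \<alpha> - Poly_Mapping.single i k) =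
        (Poly_Mapping.single j k, \<alpha> - Poly_Mapping.single j k)"
    then have "Poly_Mapping.lookup (Poly_Mapping.single i k) i = Poly_Mapping.lookup (Poly_Mapping.single j k) i"
      by simp
    then show "i = j" using k by (auto simp: lookup_single when_def split: if_splits)
  qed
  have "mcoeff (power_sum k * F) \<alpha> =
      (\<Sum>(\<beta>, \<gamma>)\<in>splits \<alpha>. (if \<exists>i. \<beta> = Poly_Mapping.single i k then 1 else 0) * mcoeff F \<gamma>)"
    by (simp add: times_symfun.rep_eq conv_def power_sum.rep_eq)
  also have "\<dots> = (\<Sum>(\<beta>, \<gamma>)\<in>splits \<alpha>. if \<exists>i. \<beta> = Poly_Mapping.single i k then mcoeff F \<gamma> else 0)"
    by (intro sum.cong) auto
  also have "\<dots> = (\<Sum>(\<beta>, \<gamma>)\<in>{(\<beta>, \<gamma>) \<in> splits \<alpha>. \<exists>i. \<beta> = Poly_Mapping.single i k}. mcoeff F \<gamma>)"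
    using sum.inter_filter[OF finite_splits[of \<alpha>], of "\<lambda>p. mcoeff F (snd p)"
        "\<lambda>p. \<exists>i. fst p = Poly_Mapping.single i k"]
    by (simp add: case_prod_unfold)
  also have "\<dots> = (\<Sum>i | k \<le> Poly_Mapping.lookup \<alpha> i. mcoeff F (\<alpha> - Poly_Mapping.single i k))"
    unfolding splits_single by (simp add: sum.reindex[OF inj])
  finally show ?thesis .
qed

lemma exponents_minus_single:
  assumes k: "k > 0" and le: "k \<le> Poly_Mapping.lookup \<alpha> i"
  shows "exponents (\<alpha> - Poly_Mapping.single i k) =
    exponents \<alpha> - {#Poly_Mapping.lookup \<alpha> i#}
      + (if Poly_Mapping.lookup \<alpha> i = k then {#} else {#Poly_Mapping.lookup \<alpha> i - k#})"
proof -
  let ?\<alpha>' = "\<alpha> - Poly_Mapping.single i k"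
  define K where "K = Poly_Mapping.keys \<alpha> - {i}"
  have i: "i \<in> Poly_Mapping.keys \<alpha>"
    using assms by (simp add: in_keys_iff)
  then have K: "Poly_Mapping.keys \<alpha> = insert i K" "i \<notin> K" "finite K"
    by (auto simp: K_def)
  have K': "Poly_Mapping.keys ?\<alpha>' = (if Poly_Mapping.lookup \<alpha> i = k then K else insert i K)"
    using le i by (auto simp: in_keys_iff K_def lookup_minus lookup_single when_def split: if_splits)
  have eq: "image_mset (Poly_Mapping.lookup ?\<alpha>') (mset_set K) = image_mset (Poly_Mapping.lookup \<alpha>) (mset_set K)"
    using K by (intro image_mset_cong) (auto simp: lookup_minus lookup_single when_def)
  show ?thesis
    using K by (simp add: exponents_def K' eq lookup_minus)
qed

text \<open>
  The monomial symmetric functions depend on the multiset of parts only; indexing them by multisets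
  avoids sorting whenever a part is changed.
\<close>

definition msym :: "nat multiset \<Rightarrow> qfield symfun" where
  "msym V = monomial_sym (sorted_list_of_multiset V)"

lemma mcoeff_msym: "mcoeff (msym V) \<alpha> = (if exponents \<alpha> = V then 1 else 0)"
  by (simp add: msym_def monomial_sym.rep_eq)

lemma monomial_sym_eq_msym: "monomial_sym \<nu> = msym (mset \<nu>)"
  by (simp add: mcoeff_inject[symmetric] fun_eq_iff mcoeff_msym monomial_sym.rep_eq)

lemma mcoeff_power_sum_msym:
  assumes k: "k > 0"
  shows "mcoeff (power_sum k * msym V) \<alpha> = lower k (\<lambda>M. if M = V then 1 else 0) (exponents \<alpha>)"
proof -
  let ?f = "\<lambda>j. (if k \<le> j then if exponents \<alpha> - {#j#} + (if j = k then {#} else {#j - k#}) = V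
                  then 1 else 0 else 0) :: qfield"
  have "lower k (\<lambda>M. if M = V then 1 else 0) (exponents \<alpha>) =
      (\<Sum>j\<in>#exponents \<alpha>. ?f j)"
    by (simp add: lower_def)
  also have "\<dots> = (\<Sum>i\<in>Poly_Mapping.keys \<alpha>. ?f (Poly_Mapping.lookup \<alpha> i))"
    unfolding exponents_def[of \<alpha>] image_mset.compositionality sum_unfold_sum_mset by (simp add: o_def)
  also have "\<dots> = (\<Sum>i\<in>{i\<in>Poly_Mapping.keys \<alpha>. k \<le> Poly_Mapping.lookup \<alpha> i}.
      if exponents \<alpha> - {#Poly_Mapping.lookup \<alpha> i#} + (if Poly_Mapping.lookup \<alpha> i = k then {#}
        else {#Poly_Mapping.lookup \<alpha> i - k#}) = V then 1 else 0)"
    by (rule sum.inter_filter[symmetric]) simp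
  also have "{i\<in>Poly_Mapping.keys \<alpha>. k \<le> Poly_Mapping.lookup \<alpha> i} = {i. k \<le> Poly_Mapping.lookup \<alpha> i}"
    using k by (auto simp: in_keys_iff)
  finally show ?thesis
    unfolding mcoeff_power_sum_mult[OF k]
    by (simp only: mcoeff_msym) (intro sum.cong refl, simp add: exponents_minus_single[OF k])
qed

text \<open>
  The \<open>U\<close> for which \<open>m\<^sub>U\<close> occurs in \<open>p\<^sub>k m\<^sub>V\<close>: the factor \<open>x\<^sub>i\<^sup>k\<close> either meets a variable that is not
  in the monomial or raises one of its exponents.  The coefficient of \<open>m\<^sub>U\<close> is the value at \<open>U\<close> of
  \<open>lower k\<close> applied to the indicator function of \<open>V\<close>.
\<close>

definition raise :: "nat \<Rightarrow> nat multiset \<Rightarrow> nat multiset set" where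
  "raise k V = insert (add_mset k V) ((\<lambda>j. add_mset (j + k) (V - {#j#})) ` set_mset V)"

lemma finite_raise [simp]: "finite (raise k V)"
  by (simp add: raise_def)

lemma lower_indicator_outside:
  assumes "U \<notin> raise k V"
  shows "lower k (\<lambda>M. if M = V then 1 else 0) U = 0"
proof -
  have "U - {#j#} + (if j = k then {#} else {#j - k#}) \<noteq> V" if j: "j \<in># U" "k \<le> j" for j
  proof
    assume V: "U - {#j#} + (if j = k then {#} else {#j - k#}) = V"
    show False
    proof (cases "j = k")
      case True
      then have "U = add_mset k V" using V j by auto
      then show False using assms by (simp add: raise_def)
    next
      case False
      then have "U = add_mset (j - k + k) (V - {#j - k#})" "j - k \<in># V"
        using V j by auto
      then show False using assms by (auto simp: raise_def)
    qed
  qed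
  then show ?thesis
    unfolding lower_def by (intro sum_mset.neutral) auto
qed

lemma lower_indicator_expand:
  "lower k (\<lambda>M. if M = V then 1 else 0) M =
     (\<Sum>U\<in>raise k V. lower k (\<lambda>M. if M = V then 1 else 0) U * (if M = U then 1 else 0))"
  using lower_indicator_outside[of M k V] by (auto simp: if_distrib[of "\<lambda>x. _ * x"] cong: if_cong)

lemma lower_indicator_add_mset_nonzero:
  "lower k (\<lambda>M. if M = V then 1 else 0) (add_mset k V) \<noteq> 0"
proof -
  have "lower k (\<lambda>M. if M = V then 1 else 0) M =
    of_nat (size {#j \<in># M. k \<le> j \<and> M - {#j#} + (if j = k then {#} else {#j - k#}) = V#})" for M
  proof -
    have "(\<Sum>j\<in>#N. if P j then if Q j then 1 else 0 else 0 :: qfield) = of_nat (size {#j \<in># N. P j \<and> Q j#})"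
      for N :: "nat multiset" and P Q
      by (induction N) auto
    then show ?thesis by (simp add: lower_def)
  qed
  then have "lower k (\<lambda>M. if M = V then 1 else 0) (add_mset k V) = 0 \<longleftrightarrow>
    {#j \<in># add_mset k V. k \<le> j \<and> add_mset k V - {#j#} + (if j = k then {#} else {#j - k#}) = V#} = {#}"
    by (simp only: of_nat_qfield_eq_0_iff size_eq_0_iff_empty)
  then show ?thesis by simp
qed

lemma mcoeff_sum: "mcoeff (\<Sum>i\<in>I. f i) \<alpha> = (\<Sum>i\<in>I. mcoeff (f i) \<alpha>)"
  by (induction I rule: infinite_finite_induct) (simp_all add: zero_symfun.rep_eq plus_symfun.rep_eq)

lemma power_sum_mult_msym:
  assumes "k > 0"
  shows "power_sum k * msym V =
    (\<Sum>U\<in>raise k V. sscale (lower k (\<lambda>M. if M = V then 1 else 0) U) (msym U))"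
  by (simp add: mcoeff_inject[symmetric] fun_eq_iff mcoeff_sum sscale.rep_eq mcoeff_msym
      mcoeff_power_sum_msym[OF assms]) (subst lower_indicator_expand, simp)


section \<open>The plethysm in the monomial basis\<close>

lemma algebra_hom_sum:
  assumes "algebra_hom \<Phi>"
  shows "\<Phi> (\<Sum>i\<in>I. f i) = (\<Sum>i\<in>I. \<Phi> (f i))"
proof -
  have "\<Phi> 0 + \<Phi> 0 = \<Phi> 0"
    using assms by (metis algebra_hom_def add_0)
  then have "\<Phi> 0 = 0" by simp
  then show ?thesis
    using assms by (induction I rule: infinite_finite_induct) (auto simp: algebra_hom_def)
qed

lemma mcoeff_power_sum_mult_nth:
  fixes F :: "'a::comm_ring_1 symfun"
  assumes k: "k > 0"
  shows "mcoeff (power_sum k * F) (Poly_Mapping.nth b) =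
    (\<Sum>i<length b. if k \<le> b ! i then mcoeff F (Poly_Mapping.nth (b[i := b ! i - k])) else 0)"
proof -
  have eq: "Poly_Mapping.nth b - Poly_Mapping.single i k = Poly_Mapping.nth (b[i := b ! i - k])"
    if "i < length b" "k \<le> b ! i" for i
    using that by (intro poly_mapping_eqI)
      (auto simp: lookup_minus lookup_single when_def nth_default_def nth_list_update)
  have "{i. k \<le> Poly_Mapping.lookup (Poly_Mapping.nth b) i} = {i\<in>{..<length b}. k \<le> b ! i}"
    using k by (auto simp: nth_default_def split: if_splits)
  then have "mcoeff (power_sum k * F) (Poly_Mapping.nth b) =
      (\<Sum>i\<in>{i\<in>{..<length b}. k \<le> b ! i}. mcoeff F (Poly_Mapping.nth (b[i := b ! i - k])))"
    unfolding mcoeff_power_sum_mult[OF k] using eq by simp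
  also have "\<dots> = (\<Sum>i<length b. if k \<le> b ! i then mcoeff F (Poly_Mapping.nth (b[i := b ! i - k])) else 0)"
    by (rule sum.inter_filter) simp
  finally show ?thesis .
qed

text \<open>
  The start of the induction below: the symmetric function 1 has \<open>x\<^sup>b\<close> with coefficient 1 exactly
  if \<open>b\<close> is zero.
\<close>

lemma pspec_indicator_empty:
  "pspec b (\<lambda>M. if M = {#} then 1 else 0) = (if Poly_Mapping.nth b = 0 then 1 else 0)"
proof -
  have spec: "spec n (\<lambda>A. if A = {#} then c else 0) = (if n = 0 then c else 0)" for n c
    using spec_scale[of _ 0 "\<lambda>_. 0"] by (simp add: spec.simps[of n])
  have "pspec b (\<lambda>M. if M = {#} then 1 else 0) = (if set b \<subseteq> {0} then 1 else 0)"
  proof (induction b)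
    case (Cons n b)
    have "(\<lambda>A. pspec b (\<lambda>B. if A + B = {#} then 1 else 0)) =
      (\<lambda>A. if A = {#} then (if set b \<subseteq> {0} then 1 else 0) else 0)"
      using Cons pspec_scale[of b 0 "\<lambda>_. 0"] by (intro ext) simp
    then show ?case by (simp add: spec)
  qed simp
  moreover have "Poly_Mapping.nth b = 0 \<longleftrightarrow> set b \<subseteq> {0}"
  proof
    assume "Poly_Mapping.nth b = 0"
    then have "nth_default 0 b i = 0" for i
      by (metis lookup_nth lookup_zero)
    then show "set b \<subseteq> {0}"
      by (auto simp: in_set_conv_nth) (metis nth_default_nth)
  next
    assume "set b \<subseteq> {0}"
    then show "Poly_Mapping.nth b = 0"
      by (intro poly_mapping_eqI) (force simp: nth_default_def)
  qed
  ultimately show ?thesis by simp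
qed

text \<open>
  In \<open>p\<^sub>k m\<^sub>V\<close> all \<open>m\<^sub>U\<close> have as many parts as \<open>V\<close>, except for the one with \<open>U = V \<union> {k}\<close>, whose
  coefficient is a positive integer.  So an algebra homomorphism is determined on the monomial
  basis, by induction on the number of parts, by its values on the power sums.  The homomorphism
  property of \<open>\<Phi>\<close> and \<open>pspec_lower\<close> say that both sides of the claim satisfy the same recursion.
\<close>

theorem mcoeff_plethysm_msym:
  assumes \<Phi>: "is_plethysm \<Phi>" and V: "0 \<notin># V"
  shows "mcoeff (\<Phi> (msym V)) (Poly_Mapping.nth b) = pspec b (\<lambda>M. if M = V then 1 else 0)"
  using V
proof (induction "size V" arbitrary: V b)
  case 0
  have "exponents \<alpha> = {#} \<longleftrightarrow> \<alpha> = 0" for \<alpha>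
    by (simp add: exponents_def mset_set_empty_iff)
  then have "msym {#} = 1"
    by (simp add: mcoeff_inject[symmetric] fun_eq_iff mcoeff_msym one_symfun.rep_eq)
  moreover have "\<Phi> 1 = 1"
    using \<Phi> by (simp add: is_plethysm_def algebra_hom_def)
  ultimately show ?case
    using 0 by (simp add: pspec_indicator_empty one_symfun.rep_eq)
next
  case (Suc m)
  define W where "W = (\<lambda>b V. pspec b (\<lambda>M. if M = V then 1 else 0))"
  define G where "G = (\<lambda>b V. mcoeff (\<Phi> (msym V)) (Poly_Mapping.nth b))"
  obtain k V' where VV: "V = add_mset k V'"
    using Suc(2) by (metis size_eq_Suc_imp_eq_union)
  have k: "k > 0" and V': "0 \<notin># V'" "m = size V'"
    using Suc(2,3) VV by auto
  define h where "h = q ^ k / (q ^ k - 1)"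
  define N where "N = lower k (\<lambda>M. if M = V' then 1 else 0)"
  have h: "1 / (1 - inverse q ^ k) = h"
    by (simp add: h_def power_inverse divide_simps)
  have hom: "algebra_hom \<Phi>" and pk: "\<Phi> (power_sum k) = sscale h (power_sum k)"
    using \<Phi> k by (simp_all add: is_plethysm_def flip: h)
  have IH: "G b V' = W b V'" for b
    using Suc(1)[OF V'(2,1)] by (simp add: G_def W_def)
  have IH': "G b (add_mset (j + k) (V' - {#j#})) = W b (add_mset (j + k) (V' - {#j#}))"
    if "j \<in># V'" for b j
    unfolding G_def W_def
  proof (rule Suc(1))
    show "m = size (add_mset (j + k) (V' - {#j#}))"
      using that V' by (metis size_add_mset insert_DiffM)
    show "0 \<notin># add_mset (j + k) (V' - {#j#})"
      using V' k by (auto dest: in_diffD)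
  qed
  have "(\<Sum>U\<in>raise k V'. N U * G b U) = mcoeff (\<Phi> (power_sum k * msym V')) (Poly_Mapping.nth b)"
    using hom unfolding power_sum_mult_msym[OF k] algebra_hom_sum[OF hom]
    by (simp add: mcoeff_sum G_def N_def algebra_hom_def sscale.rep_eq)
  also have "\<dots> = h * mcoeff (power_sum k * \<Phi> (msym V')) (Poly_Mapping.nth b)"
  proof -
    have "sscale h (power_sum k) * F = sscale h (power_sum k * F)" for F :: "qfield symfun"
      by (simp add: mcoeff_inject[symmetric] fun_eq_iff sscale.rep_eq times_symfun.rep_eq conv_def
          sum_distrib_left mult.assoc case_prod_unfold)
    then show ?thesis
      using hom by (simp add: algebra_hom_def pk sscale.rep_eq)
  qed
  also have "\<dots> = h * (\<Sum>i<length b. if k \<le> b ! i then W (b[i := b ! i - k]) V' else 0)"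
    unfolding mcoeff_power_sum_mult_nth[OF k] IH[symmetric] G_def ..
  also have "\<dots> = pspec b N"
    unfolding N_def pspec_lower[OF k] h_def W_def ..
  also have "\<dots> = (\<Sum>U\<in>raise k V'. N U * W b U)"
  proof -
    have "N = (\<lambda>M. \<Sum>U\<in>raise k V'. N U * (if M = U then 1 else 0))"
      unfolding N_def by (rule ext) (rule lower_indicator_expand)
    then have "pspec b N = pspec b (\<lambda>M. \<Sum>U\<in>raise k V'. N U * (if M = U then 1 else 0))"
      by (rule arg_cong)
    then show ?thesis
      unfolding pspec_sum pspec_scale W_def .
  qed
  finally have eq: "(\<Sum>U\<in>raise k V'. N U * (G b U - W b U)) = 0"
    by (simp add: sum_subtractf right_diff_distrib)
  \<comment> \<open>By the induction hypothesis only the summand with one more part survives.\<close>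
  have "(\<Sum>U\<in>raise k V'. N U * (G b U - W b U)) = (\<Sum>U\<in>{V}. N U * (G b U - W b U))"
    using IH' by (intro sum.mono_neutral_right) (auto simp: raise_def VV)
  with eq have "N V * (G b V - W b V) = 0" by simp
  moreover have "N V \<noteq> 0"
    unfolding N_def VV by (rule lower_indicator_add_mset_nonzero)
  ultimately show ?case
    by (simp add: G_def W_def)
qed

section \<open>Lengths of permutations\<close>

lemma Sym_compose: "u \<in> Sym n \<Longrightarrow> v \<in> Sym n \<Longrightarrow> u \<circ> v \<in> Sym n"
  by (simp add: Sym_def permutes_compose)

lemma simple_refl_Sym: "i \<in> {1..<n} \<Longrightarrow> simple_refl i \<in> Sym n"
  by (auto simp: Sym_def intro!: permutes_swap_id)

lemma finite_Sym [simp]: "finite (Sym n)"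
  by (simp add: Sym_def finite_permutations)

definition inversions :: "nat \<Rightarrow> (nat \<Rightarrow> nat) \<Rightarrow> (nat \<times> nat) set" where
  "inversions n w = {(i, j). 1 \<le> i \<and> i < j \<and> j \<le> n \<and> w j < w i}"

lemma finite_inversions [simp]: "finite (inversions n w)"
  by (rule finite_subset[of _ "{..n} \<times> {..n}"]) (auto simp: inversions_def)

lemma len_eq: "len n w = card (inversions n w)"
  by (simp add: len_def inversions_def)

text \<open>
  The transposition permutes the other inversions among themselves and adds \<open>(i, i + 1)\<close>.
\<close>

lemma len_comp_ascent:
  assumes w: "w \<in> Sym n" and i: "i \<in> {1..<n}" and asc: "w i < w (Suc i)"
  shows "len n (w \<circ> simple_refl i) = len n w + 1"
proof -
  let ?s = "simple_refl i"
  have "inversions n (w \<circ> ?s) = insert (i, Suc i) (map_prod ?s ?s ` inversions n w)"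
  proof (intro set_eqI iffI)
    fix p assume p: "p \<in> inversions n (w \<circ> ?s)"
    obtain a b where ab: "p = (a, b)" by (cases p)
    show "p \<in> insert (i, Suc i) (map_prod ?s ?s ` inversions n w)"
    proof (cases "p = (i, Suc i)")
      case False
      have "(?s a, ?s b) \<in> inversions n w"
        using p ab False i asc by (auto simp: inversions_def transpose_def split: if_splits)
      then have "map_prod ?s ?s (?s a, ?s b) \<in> map_prod ?s ?s ` inversions n w"
        by (rule imageI)
      then show ?thesis by (simp add: ab)
    qed simp
  next
    fix p assume "p \<in> insert (i, Suc i) (map_prod ?s ?s ` inversions n w)"
    then consider "p = (i, Suc i)" | a b where "(a, b) \<in> inversions n w" "p = (?s a, ?s b)"
      by auto
    then show "p \<in> inversions n (w \<circ> ?s)"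
    proof cases
      case 1
      then show ?thesis using i asc by (simp add: inversions_def)
    next
      case 2
      moreover have "\<not> (a = i \<and> b = Suc i)"
        using 2(1) asc by (auto simp: inversions_def)
      ultimately show ?thesis
        using i by (auto simp: inversions_def transpose_def)
    qed
  qed
  moreover have "(i, Suc i) \<notin> map_prod ?s ?s ` inversions n w"
    by (auto simp: inversions_def transpose_def split: if_splits)
  moreover have "inj_on (map_prod ?s ?s) (inversions n w)"
    by (intro inj_on_subset[OF prod.inj_map]) auto
  ultimately show ?thesis
    by (simp add: len_eq card_image)
qed

lemma len_comp_cases:
  assumes w: "w \<in> Sym n" and i: "i \<in> {1..<n}"
  shows "len n (w \<circ> simple_refl i) = len n w + 1 \<or> len n w = len n (w \<circ> simple_refl i) + 1"
proof -
  have "w i \<noteq> w (Suc i)"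
    using w permutes_inj[of w "{1..n}"] inj_eq[of w i "Suc i"] by (simp add: Sym_def)
  then consider "w i < w (Suc i)" | "(w \<circ> simple_refl i) i < (w \<circ> simple_refl i) (Suc i)"
    by (metis comp_apply linorder_neqE_nat transpose_apply_first transpose_apply_second)
  then show ?thesis
  proof cases
    case 1
    then show ?thesis using len_comp_ascent[OF w i] by simp
  next
    case 2
    then show ?thesis
      using len_comp_ascent[OF Sym_compose[OF w simple_refl_Sym[OF i]] i] by (simp add: comp_assoc)
  qed
qed

lemma len_inv:
  assumes w: "w \<in> Sym n"
  shows "len n (inv w) = len n w"
proof -
  have p: "w permutes {1..n}" using w by (simp add: Sym_def)
  have le: "inversions n (inv v) \<subseteq> (\<lambda>(i, j). (v j, v i)) ` inversions n v"
    if v: "v permutes {1..n}" for v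
  proof clarify
    fix a b assume ab: "(a, b) \<in> inversions n (inv v)"
    have "inv v a \<in> {1..n}" "inv v b \<in> {1..n}"
      using ab permutes_in_image[OF permutes_inv[OF v], of a] permutes_in_image[OF permutes_inv[OF v], of b]
      unfolding inversions_def by auto
    then have "(inv v b, inv v a) \<in> inversions n v"
      using ab by (auto simp: inversions_def permutes_inverses[OF v])
    then show "(a, b) \<in> (\<lambda>(i, j). (v j, v i)) ` inversions n v"
      by (auto simp: permutes_inverses[OF v] intro!: image_eqI[of _ _ "(inv v b, inv v a)"])
  qed
  have "len n (inv v) \<le> len n v" if v: "v permutes {1..n}" for v
    unfolding len_eq using le[OF v] by (rule surj_card_le[OF finite_inversions])
  from this[OF p] this[OF permutes_inv[OF p]] show ?thesis
    by (simp add: permutes_inv_inv[OF p])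
qed

lemma len_simple_refl_comp_cases:
  assumes w: "w \<in> Sym n" and i: "i \<in> {1..<n}"
  shows "len n (simple_refl i \<circ> w) = len n w + 1 \<or> len n w = len n (simple_refl i \<circ> w) + 1"
proof -
  have p: "w permutes {1..n}" using w by (simp add: Sym_def)
  have w': "inv w \<in> Sym n" using p by (simp add: Sym_def permutes_inv)
  have "inv (simple_refl i \<circ> w) = inv w \<circ> simple_refl i"
    using p by (simp add: o_inv_distrib permutes_bij)
  then show ?thesis
    using len_comp_cases[OF w' i] len_inv[OF w] len_inv[OF Sym_compose[OF simple_refl_Sym[OF i] w]]
    by simp
qed

lemma len_id [simp]: "len n id = 0"
proof -
  have "inversions n id = {}" by (auto simp: inversions_def)
  then show ?thesis by (simp add: len_eq)
qed

text \<open>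
  \<open>J\<close> consists of the indices of the simple reflections in a reduced word of \<open>w\<close>.  An initial segment
  \<open>{1..k}\<close> is preserved by every simple reflection other than the one that exchanges \<open>k\<close> and \<open>k + 1\<close>.
\<close>

lemma exists_support:
  assumes "w \<in> Sym n"
  shows "\<exists>J\<subseteq>{1..<n}. card J \<le> len n w \<and> (\<forall>k\<in>{1..n} - J. w ` {1..k} = {1..k})"
  using assms
proof (induction "len n w" arbitrary: w rule: less_induct)
  case less
  have p: "w permutes {1..n}" using less.prems by (simp add: Sym_def)
  show ?case
  proof (cases "\<exists>i\<in>{1..<n}. w (Suc i) < w i")
    case True
    then obtain i where i: "i \<in> {1..<n}" and des: "w (Suc i) < w i" by blast
    let ?v = "w \<circ> simple_refl i"
    have v: "?v \<in> Sym n" by (rule Sym_compose[OF less.prems simple_refl_Sym[OF i]])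
    have vs: "?v \<circ> simple_refl i = w" by (simp add: comp_assoc)
    have len: "len n w = len n ?v + 1"
      using len_comp_ascent[OF v i] des unfolding vs by simp
    obtain J where J: "J \<subseteq> {1..<n}" "card J \<le> len n ?v"
      "\<And>k. k \<in> {1..n} - J \<Longrightarrow> ?v ` {1..k} = {1..k}"
      using less.hyps[OF _ v] len by fastforce
    have "w ` {1..k} = {1..k}" if k: "k \<in> {1..n} - insert i J" for k
    proof -
      have "simple_refl i ` {1..k} = {1..k}"
      proof (cases "i < k")
        case True
        then have "simple_refl i permutes {1..k}" using i by (intro permutes_swap_id) auto
        then show ?thesis by (rule permutes_image)
      next
        case False
        then show ?thesis using k i by (auto simp: transpose_def image_iff)
      qed
      then have "w ` {1..k} = ?v ` {1..k}"
        by (metis image_comp)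
      then show ?thesis using J(3) k by simp
    qed
    moreover have "card (insert i J) \<le> len n w"
      using J(2) len finite_subset[OF J(1)]
      by (simp add: card_insert_if)
    ultimately show ?thesis
      using J(1) i by (intro exI[of _ "insert i J"]) auto
  next
    case False
    then have mono: "w i < w (Suc i)" if "i \<in> {1..<n}" for i
      using that permutes_inj[OF p] by (metis inj_eq linorder_neqE_nat n_not_Suc_n)
    have ge: "k \<le> w k" if "k \<in> {1..n}" for k
      using that
    proof (induction k)
      case (Suc k)
      show ?case
      proof (cases "k = 0")
        case True
        then show ?thesis using permutes_in_image[OF p, of 1] Suc.prems by auto
      next
        case False
        then have "k \<le> w k" "w k < w (Suc k)" using Suc mono[of k] by auto
        then show ?thesis by simp
      qed
    qed simp
    have "w = id"
      by (rule permutes_natset_ge[OF p]) (use ge in auto)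
    then show ?thesis
      by (intro exI[of _ "{}"]) simp
  qed
qed

text \<open>
  An initial segment that \<open>w\<close> preserves contains the whole cycle of its last element; hence distinct indices outside the
  support of \<open>w\<close> lie on distinct cycles.
\<close>

lemma orbit_count_bound:
  assumes w: "w \<in> Sym n"
  shows "n \<le> card (orbit w ` {1..n}) + len n w"
proof -
  have p: "w permutes {1..n}" using w by (simp add: Sym_def)
  obtain J where J: "J \<subseteq> {1..<n}" "card J \<le> len n w"
    "\<And>k. k \<in> {1..n} - J \<Longrightarrow> w ` {1..k} = {1..k}"
    using exists_support[OF w] by blast
  have fin: "finite J" using J(1) by (rule finite_subset) simp
  have sub: "orbit w k \<subseteq> {1..k}" if k: "k \<in> {1..n} - J" for k
  proof
    fix x assume "x \<in> orbit w k"
    then show "x \<in> {1..k}"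
      by induction (use J(3)[OF k] k in auto)
  qed
  have self: "k \<in> orbit w k" for k
    by (rule permutation_self_in_orbit[OF permutation_permutes[THEN iffD2]]) (use p in auto)
  have "inj_on (orbit w) ({1..n} - J)"
  proof (rule inj_onI)
    fix k l assume kl: "k \<in> {1..n} - J" "l \<in> {1..n} - J" "orbit w k = orbit w l"
    have "k \<in> {1..l}"
      using sub[OF kl(2)] self[of k] kl(3) by blast
    moreover have "l \<in> {1..k}"
      using sub[OF kl(1)] self[of l] kl(3) by blast
    ultimately show "k = l" by simp
  qed
  then have "card ({1..n} - J) = card (orbit w ` ({1..n} - J))"
    by (simp add: card_image)
  also have "\<dots> \<le> card (orbit w ` {1..n})"
    by (intro card_mono) auto
  finally show ?thesis
    using J(1,2) card_Diff_subset[OF fin, of "{1..n}"] by fastforce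
qed

section \<open>Coxeter elements of Young subgroups\<close>

text \<open>
  The increasing cycle \<open>m \<mapsto> m + 1 \<mapsto> \<dots> \<mapsto> m + b \<mapsto> m\<close>, built up from the left because the averaging
  argument for Young subgroups extends it at its lower end.
\<close>

fun up_cycle :: "nat \<Rightarrow> nat \<Rightarrow> (nat \<Rightarrow> nat)" where
  "up_cycle m 0 = id"
| "up_cycle m (Suc b) = simple_refl m \<circ> up_cycle (Suc m) b"

lemma up_cycle_apply: "up_cycle m b i = (if m \<le> i \<and> i < m + b then Suc i else if i = m + b then m else i)"
  by (induction b arbitrary: m) (auto simp: transpose_def)

lemma len_up_cycle_comp:
  assumes "w \<in> Sym n" "1 \<le> m" "m + b \<le> n"
  shows "up_cycle m b \<circ> w \<in> Sym n \<and> len n (up_cycle m b \<circ> w) \<le> len n w + b"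
  using assms(2-)
proof (induction b arbitrary: m)
  case 0
  then show ?case using assms(1) by simp
next
  case (Suc b)
  let ?v = "up_cycle (Suc m) b \<circ> w"
  have m: "m \<in> {1..<n}"
    using Suc.prems by simp
  have "?v \<in> Sym n \<and> len n ?v \<le> len n w + b"
    by (rule Suc.IH) (use Suc.prems in auto)
  then have v: "?v \<in> Sym n" "len n ?v \<le> len n w + b"
    by blast+
  have "len n (simple_refl m \<circ> ?v) \<le> len n ?v + 1"
    using len_simple_refl_comp_cases[OF v(1) m] by linarith
  then have "len n (simple_refl m \<circ> ?v) \<le> len n w + Suc b"
    using v(2) by linarith
  moreover have "up_cycle m (Suc b) \<circ> w = simple_refl m \<circ> ?v"
    unfolding up_cycle.simps comp_assoc ..
  ultimately show ?case
    using Sym_compose[OF simple_refl_Sym[OF m] v(1)] by metis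
qed

text \<open>
  A Coxeter element of the Young subgroup that permutes consecutive blocks of the sizes in \<open>\<alpha>\<close>, the
  first of which starts at \<open>N + 1\<close>.
\<close>

fun coxeter :: "nat \<Rightarrow> nat list \<Rightarrow> (nat \<Rightarrow> nat)" where
  "coxeter N [] = id"
| "coxeter N (k # \<alpha>) = up_cycle (Suc N) (k - 1) \<circ> coxeter (N + k) \<alpha>"

lemma up_cycle_permutes: "up_cycle m b permutes {m..m + b}"
proof (induction b arbitrary: m)
  case (Suc b)
  have "up_cycle (Suc m) b permutes {m..m + Suc b}"
    by (rule permutes_subset[OF Suc]) auto
  moreover have "simple_refl m permutes {m..m + Suc b}"
    by (rule permutes_swap_id) auto
  ultimately show ?case
    unfolding up_cycle.simps by (rule permutes_compose)
qed simp

lemma coxeter_permutes: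
  "0 \<notin> set \<alpha> \<Longrightarrow> coxeter N \<alpha> permutes {N<..N + sum_list \<alpha>}"
proof (induction \<alpha> arbitrary: N)
  case (Cons k \<alpha>)
  have "coxeter (N + k) \<alpha> permutes {N<..N + sum_list (k # \<alpha>)}"
    by (rule permutes_subset[OF Cons.IH]) (use Cons.prems in auto)
  moreover have "up_cycle (Suc N) (k - 1) permutes {N<..N + sum_list (k # \<alpha>)}"
    by (rule permutes_subset[OF up_cycle_permutes]) (use Cons.prems in auto)
  ultimately show ?case
    unfolding coxeter.simps by (rule permutes_compose)
qed simp

lemma len_coxeter:
  assumes "0 \<notin> set \<alpha>" "N + sum_list \<alpha> \<le> n"
  shows "coxeter N \<alpha> \<in> Sym n \<and> len n (coxeter N \<alpha>) + length \<alpha> \<le> sum_list \<alpha>"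
  using assms
proof (induction \<alpha> arbitrary: N)
  case Nil
  have "id \<in> Sym n" unfolding Sym_def by (simp only: mem_Collect_eq permutes_id)
  then show ?case using len_id[of n] by (simp add: id_def)
next
  case (Cons k \<alpha>)
  then have v: "coxeter (N + k) \<alpha> \<in> Sym n" "len n (coxeter (N + k) \<alpha>) + length \<alpha> \<le> sum_list \<alpha>"
    and k: "k > 0"
    using Cons.IH[of "N + k"] by auto
  have eq: "coxeter N (k # \<alpha>) = up_cycle (Suc N) (k - 1) \<circ> coxeter (N + k) \<alpha>"
    by (rule coxeter.simps)
  have "up_cycle (Suc N) (k - 1) \<circ> coxeter (N + k) \<alpha> \<in> Sym n \<and>
      len n (up_cycle (Suc N) (k - 1) \<circ> coxeter (N + k) \<alpha>) \<le> len n (coxeter (N + k) \<alpha>) + (k - 1)"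
    by (rule len_up_cycle_comp[OF v(1)]) (use Cons.prems k in auto)
  then show ?case
    unfolding eq[symmetric] using v(2) k by (auto simp del: coxeter.simps)
qed

lemma orbit_up_cycle:
  assumes k: "k > 0" and w: "\<And>i. i \<in> {N<..N + k} \<Longrightarrow> w i = up_cycle (Suc N) (k - 1) i"
    and i: "i \<in> {N<..N + k}"
  shows "orbit w i = {N<..N + k}"
proof -
  have pow: "(w ^^ j) (Suc N) = Suc N + j" if "j < k" for j
    using that by (induction j) (auto simp: w up_cycle_apply)
  have "(w ^^ k) (Suc N) = w ((w ^^ (k - 1)) (Suc N))"
    using k by (cases k) auto
  also have "\<dots> = Suc N"
    using k by (simp add: pow w up_cycle_apply)
  finally have "orbit w (Suc N) = {(w ^^ m) (Suc N) | m. m < k}"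
    by (rule orbit_altdef_bounded[OF _ k])
  also have "\<dots> = {Suc N + m | m. m < k}"
    by (intro Collect_cong ex_cong1) (auto simp: pow)
  also have "\<dots> = {N<..N + k}"
  proof (intro set_eqI iffI)
    fix x assume "x \<in> {N<..N + k}"
    then have "x = Suc N + (x - Suc N)" "x - Suc N < k" by auto
    then show "x \<in> {Suc N + m | m. m < k}"
      by (intro CollectI exI[of _ "x - Suc N"] conjI)
  qed auto
  finally have "orbit w (Suc N) = {N<..N + k}" .
  then have "cyclic_on w {N<..N + k}"
    unfolding cyclic_on_def by (intro bexI[of _ "Suc N"]) (use k in simp_all)
  then show ?thesis
    using i by (rule orbit_cyclic_eq3)
qed

lemma orbit_sizes_coxeter:
  assumes "0 \<notin> set \<alpha>"
  shows "image_mset card (mset_set (orbit (coxeter N \<alpha>) ` {N<..N + sum_list \<alpha>})) = mset \<alpha>"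
  using assms
proof (induction \<alpha> arbitrary: N)
  case (Cons k \<alpha>)
  define v w where "v = coxeter (N + k) \<alpha>" and "w = coxeter N (k # \<alpha>)"
  define B C where "B = {N<..N + k}" and "C = {N + k<..N + k + sum_list \<alpha>}"
  have k: "k > 0" and \<alpha>: "0 \<notin> set \<alpha>" using Cons.prems by auto
  have v: "v permutes C"
    unfolding v_def C_def by (rule coxeter_permutes[OF \<alpha>])
  have wB: "w i = up_cycle (Suc N) (k - 1) i" if "i \<in> B" for i
    using that permutes_not_in[OF v, of i] by (simp add: w_def B_def C_def flip: v_def)
  have wC: "w i = v i" if "i \<in> C" for i
    using that permutes_in_image[OF v, of i] k by (auto simp: w_def C_def up_cycle_apply simp flip: v_def)
  have orbB: "orbit w i = B" if "i \<in> B" for i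
    using orbit_up_cycle[OF k] wB that unfolding B_def by blast
  have orbC: "orbit w i = orbit v i \<and> orbit v i \<subseteq> C" if i: "i \<in> C" for i
  proof -
    have sub: "x \<in> C" if "x \<in> orbit v i" for x
      using that by induction (simp_all add: i permutes_in_image[OF v])
    have "x \<in> orbit w i" if "x \<in> orbit v i" for x
      using that
    proof induction
      case base
      show ?case using orbit.base[of w i] wC[OF i] by simp
    next
      case (step y)
      show ?case using orbit.step[OF step.IH] wC[OF sub[OF step.hyps]] by simp
    qed
    moreover have "x \<in> orbit v i" if "x \<in> orbit w i" for x
      using that
    proof induction
      case base
      show ?case using orbit.base[of v i] wC[OF i] by simp
    next
      case (step y)
      show ?case using orbit.step[OF step.IH] wC[OF sub[OF step.IH]] by simp
    qed
    ultimately show ?thesis using sub by blast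
  qed
  have "{N<..N + sum_list (k # \<alpha>)} = B \<union> C" by (auto simp: B_def C_def)
  moreover have "orbit w ` B = {B}"
  proof -
    have "Suc N \<in> B" using k by (simp add: B_def)
    then show ?thesis using orbB by (auto intro!: image_eqI[of B "orbit w" "Suc N"])
  qed
  moreover have "orbit w ` C = orbit v ` C"
    using orbC by (intro image_cong) auto
  ultimately have "orbit w ` {N<..N + sum_list (k # \<alpha>)} = insert B (orbit v ` C)"
    by (simp add: image_Un)
  moreover have "B \<notin> orbit v ` C"
  proof
    assume "B \<in> orbit v ` C"
    then have "B \<subseteq> C" using orbC by auto
    then show False using k by (auto simp: B_def C_def subset_iff)
  qed
  moreover have "finite (orbit v ` C)" by (simp add: C_def)
  moreover have "image_mset card (mset_set (orbit v ` C)) = mset \<alpha>"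
    unfolding v_def C_def by (rule Cons.IH[OF \<alpha>])
  ultimately have "image_mset card (mset_set (orbit w ` {N<..N + sum_list (k # \<alpha>)})) = mset (k # \<alpha>)"
    by (simp add: B_def)
  then show ?case
    unfolding w_def .
qed simp

lemma partition_mset_inject:
  assumes "\<mu> \<in> partitions n" "\<nu> \<in> partitions n" "mset \<mu> = mset \<nu>"
  shows "\<mu> = \<nu>"
proof -
  have "sorted (rev \<mu>)" "sorted (rev \<nu>)"
    using assms by (simp_all add: partitions_def sorted_wrt_rev)
  then have "rev \<mu> = rev \<nu>"
    using assms(3) by (metis mset_rev properties_for_sort)
  then show ?thesis by simp
qed

lemma length_cycle_type: "length (cycle_type n w) = card (orbit w ` {1..n})"
  by (simp add: cycle_type_def flip: size_mset)

text \<open>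
  A Coxeter element is a product of \<open>n - \<ell>(\<alpha>)\<close> simple reflections and has \<open>\<ell>(\<alpha>)\<close> cycles, so it
  attains the lower bound of \<open>orbit_count_bound\<close>.
\<close>

lemma min_length_coxeter:
  assumes "0 \<notin> set \<alpha>" "sum_list \<alpha> = n"
  shows "min_length n (rev (sorted_list_of_multiset (mset \<alpha>))) (coxeter 0 \<alpha>)"
proof -
  have eq: "{0<..0 + sum_list \<alpha>} = {1..n}" using assms(2) by auto
  have w: "coxeter 0 \<alpha> \<in> Sym n" "len n (coxeter 0 \<alpha>) + length \<alpha> \<le> n"
    using len_coxeter[OF assms(1), of 0 n] assms(2) by auto
  have ct: "cycle_type n (coxeter 0 \<alpha>) = rev (sorted_list_of_multiset (mset \<alpha>))"
    using orbit_sizes_coxeter[OF assms(1), of 0] unfolding eq by (simp add: cycle_type_def)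
  have "len n (coxeter 0 \<alpha>) \<le> len n v"
    if v: "v \<in> Sym n" "cycle_type n v = rev (sorted_list_of_multiset (mset \<alpha>))" for v
  proof -
    have "card (orbit v ` {1..n}) = length \<alpha>"
      using v(2) length_cycle_type[of n v] by simp
    then show ?thesis
      using orbit_count_bound[OF v(1)] w(2) by linarith
  qed
  then show ?thesis
    using w ct by (simp add: min_length_def conj_class_def)
qed

lemma expansion_matrix_coxeter:
  assumes \<kappa>: "is_expansion_matrix n \<kappa>" and \<nu>: "\<nu> \<in> partitions n"
    and \<alpha>: "0 \<notin> set \<alpha>" "sum_list \<alpha> = n"
  shows "\<kappa> \<nu> (coxeter 0 \<alpha>) = (if mset \<alpha> = mset \<nu> then 1 else 0)"
proof -
  define \<mu> where "\<mu> = rev (sorted_list_of_multiset (mset \<alpha>))"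
  have mset: "mset \<mu> = mset \<alpha>" by (simp add: \<mu>_def)
  have sorted: "sorted (rev \<mu>)" by (simp add: \<mu>_def)
  have "sum_list \<mu> = n" 
    using mset \<alpha>(2) by (metis sum_mset_sum_list)
  moreover have "set \<mu> = set \<alpha>"
    using mset by (metis set_mset_mset)
  moreover have "sorted_wrt (\<ge>) \<mu>"
    using sorted by (simp add: sorted_wrt_rev)
  ultimately have \<mu>: "\<mu> \<in> partitions n"
    using \<alpha>(1) by (auto simp: partitions_def intro!: gr0I)
  have "\<mu> = \<nu>" if "mset \<mu> = mset \<nu>"
    using partition_mset_inject[OF \<mu> \<nu> that] .
  then have "\<mu> = \<nu> \<longleftrightarrow> mset \<alpha> = mset \<nu>"
    using mset by auto
  moreover have "min_length n \<mu> (coxeter 0 \<alpha>)"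
    unfolding \<mu>_def by (rule min_length_coxeter[OF \<alpha>])
  ultimately show ?thesis
    using \<kappa> \<nu> \<mu> by (simp add: is_expansion_matrix_def)
qed

section \<open>Sums over Young subgroups\<close>

text \<open>
  This is the identity \<open>\<tau>(T\<^sub>s (T\<^sub>w + T\<^sub>s\<^sub>w)) = q \<tau>(T\<^sub>w + T\<^sub>s\<^sub>w)\<close> in disguise: \<open>\<kappa> \<nu>\<close> gives the values on
  the standard basis of a trace \<open>\<tau>\<close> of the Hecke algebra, and \<open>T\<^sub>w + T\<^sub>s\<^sub>w = (1 + T\<^sub>s) T\<^sub>w\<close> is a left
  eigenvector of \<open>T\<^sub>s\<close> with eigenvalue \<open>q\<close>.
\<close>

lemma expansion_pair:
  assumes \<kappa>: "is_expansion_matrix n \<kappa>" and \<nu>: "\<nu> \<in> partitions n"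
    and w: "w \<in> Sym n" and k: "k \<in> {1..<n}"
    and l1: "len n (simple_refl k \<circ> w) = len n w + 1"
    and l2: "len n (w \<circ> simple_refl k) = len n w + 1"
    and l3: "len n (simple_refl k \<circ> w \<circ> simple_refl k) = len n (simple_refl k \<circ> w) + 1"
  shows "\<kappa> \<nu> (w \<circ> simple_refl k) + \<kappa> \<nu> (simple_refl k \<circ> w \<circ> simple_refl k) =
    q * (\<kappa> \<nu> w + \<kappa> \<nu> (simple_refl k \<circ> w))"
proof -
  let ?s = "simple_refl k"
  have *: "(len n (?s \<circ> w) = len n (w \<circ> ?s) \<and> len n (?s \<circ> w) = len n w + 1
             \<longrightarrow> \<kappa> \<nu> (?s \<circ> w) = \<kappa> \<nu> (w \<circ> ?s)) \<and>
      (len n (?s \<circ> w \<circ> ?s) = len n w + 2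
             \<longrightarrow> \<kappa> \<nu> (?s \<circ> w \<circ> ?s) = q * \<kappa> \<nu> w + (q - 1) * \<kappa> \<nu> (w \<circ> ?s))"
    using \<kappa> \<nu> w k unfolding is_expansion_matrix_def Let_def by blast
  have "\<kappa> \<nu> (?s \<circ> w) = \<kappa> \<nu> (w \<circ> ?s)"
    using * l1 l2 by simp
  moreover have "\<kappa> \<nu> (?s \<circ> w \<circ> ?s) = q * \<kappa> \<nu> w + (q - 1) * \<kappa> \<nu> (w \<circ> ?s)"
    using * l1 l3 by simp
  ultimately show ?thesis
    by (simp add: algebra_simps)
qed

text \<open>
  A set that is closed under left multiplication by the simple reflection \<open>s\<close> falls into pairs
  \<open>{u, s u}\<close>, to each of which \<open>expansion_pair\<close> applies, with the shorter one of
  \<open>u z\<close> and \<open>s u z\<close> in the role of \<open>w\<close>.  The ascent at \<open>k\<close> supplies the lengths after multiplication by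
  \<open>s\<close> on the right.
\<close>

lemma expansion_shift:
  fixes Y :: "(nat \<Rightarrow> nat) set" and z :: "nat \<Rightarrow> nat"
  assumes \<kappa>: "is_expansion_matrix n \<kappa>" and \<nu>: "\<nu> \<in> partitions n"
    and k: "k \<in> {1..<n}"
    and Y: "\<And>u. u \<in> Y \<Longrightarrow> simple_refl k \<circ> u \<in> Y"
    and Sym: "\<And>u. u \<in> Y \<Longrightarrow> u \<circ> z \<in> Sym n"
    and ascent: "\<And>u. u \<in> Y \<Longrightarrow> (u \<circ> z) k < (u \<circ> z) (Suc k)"
  shows "(\<Sum>u\<in>Y. \<kappa> \<nu> (u \<circ> (z \<circ> simple_refl k))) = q * (\<Sum>u\<in>Y. \<kappa> \<nu> (u \<circ> z))"
proof -
  let ?s = "simple_refl k"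
  define f where "f = (\<lambda>u. \<kappa> \<nu> (u \<circ> (z \<circ> ?s)))"
  define g where "g = (\<lambda>u. \<kappa> \<nu> (u \<circ> z))"
  have ss: "?s \<circ> (?s \<circ> u) = u" for u :: "nat \<Rightarrow> nat"
    by (simp flip: comp_assoc)
  have invol: "(\<Sum>u\<in>Y. h (?s \<circ> u)) = (\<Sum>u\<in>Y. h u)" for h :: "(nat \<Rightarrow> nat) \<Rightarrow> qfield"
    by (rule sum.reindex_bij_witness[of _ "\<lambda>u. ?s \<circ> u" "\<lambda>u. ?s \<circ> u"]) (simp_all only: ss Y)
  have pair: "f u + f (?s \<circ> u) = q * (g u + g (?s \<circ> u))" if u: "u \<in> Y" for u
  proof -
    have up: "len n (v \<circ> z \<circ> ?s) = len n (v \<circ> z) + 1" if "v \<in> Y" for v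
      using len_comp_ascent[OF Sym[OF that] k ascent[OF that]] .
    have main: "f v + f (?s \<circ> v) = q * (g v + g (?s \<circ> v))"
      if v: "v \<in> Y" and l: "len n (?s \<circ> (v \<circ> z)) = len n (v \<circ> z) + 1" for v
    proof -
      have "\<kappa> \<nu> (v \<circ> z \<circ> ?s) + \<kappa> \<nu> (?s \<circ> (v \<circ> z) \<circ> ?s) =
          q * (\<kappa> \<nu> (v \<circ> z) + \<kappa> \<nu> (?s \<circ> (v \<circ> z)))"
        by (rule expansion_pair[OF \<kappa> \<nu> Sym[OF v] k l up[OF v]])
          (use up[OF Y[OF v]] in \<open>simp only: comp_assoc\<close>)
      then show ?thesis
        unfolding f_def g_def by (simp only: comp_assoc)
    qed
    from len_simple_refl_comp_cases[OF Sym[OF u] k] show ?thesis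
    proof
      assume "len n (u \<circ> z) = len n (?s \<circ> (u \<circ> z)) + 1"
      then have "len n (?s \<circ> ((?s \<circ> u) \<circ> z)) = len n ((?s \<circ> u) \<circ> z) + 1"
        by (simp only: comp_assoc ss)
      from main[OF Y[OF u] this] show ?thesis
        unfolding ss by (simp only: add.commute)
    qed (rule main[OF u])
  qed
  \<comment> \<open>Counting every pair twice avoids the choice of a representative.\<close>
  have "2 * (\<Sum>u\<in>Y. f u) = (\<Sum>u\<in>Y. f u + f (?s \<circ> u))"
    by (simp add: sum.distrib invol)
  also have "\<dots> = q * (\<Sum>u\<in>Y. g u + g (?s \<circ> u))"
    unfolding sum_distrib_left by (intro sum.cong refl pair)
  also have "\<dots> = 2 * (q * (\<Sum>u\<in>Y. g u))"
    by (simp add: sum.distrib invol)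
  finally show ?thesis
    by (simp add: f_def g_def)
qed

lemma young_subgroup_snoc:
  "w \<in> young_subgroup (\<rho> @ [a]) \<longleftrightarrow>
     w \<in> Sym (sum_list \<rho> + a) \<and> (\<forall>j<length \<rho>. w ` block \<rho> j = block \<rho> j) \<and>
     w ` {sum_list \<rho><..sum_list \<rho> + a} = {sum_list \<rho><..sum_list \<rho> + a}"
proof -
  have "block (\<rho> @ [a]) j = block \<rho> j" if "j < length \<rho>" for j
    using that by (simp add: block_def)
  moreover have "block (\<rho> @ [a]) (length \<rho>) = {sum_list \<rho><..sum_list \<rho> + a}"
    by (simp add: block_def)
  ultimately show ?thesis
    by (simp add: young_subgroup_def All_less_Suc conj_ac)
qed

lemma young_subgroup_snoc_0 [simp]: "young_subgroup (\<rho> @ [0]) = young_subgroup \<rho>"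
  by (auto simp: young_subgroup_snoc) (auto simp: young_subgroup_def)

lemma block_subset: "block \<rho> j \<subseteq> {1..sum_list \<rho>}"
proof -
  have "sum_list (take (Suc j) \<rho>) \<le> sum_list \<rho>"
    by (metis append_take_drop_id le_add1 sum_list_append)
  then show ?thesis
    by (auto simp: block_def)
qed

text \<open>
  The elements \<open>down_cycle N r\<close> with \<open>r \<le> a\<close> represent the cosets of the smaller Young subgroup in
  \<open>young_subgroup_snoc_Suc\<close>; \<open>down_cycle N r\<close> moves \<open>N - r\<close> to \<open>N\<close> and shifts the points in between down.
\<close>

fun down_cycle :: "nat \<Rightarrow> nat \<Rightarrow> (nat \<Rightarrow> nat)" where
  "down_cycle N 0 = id"
| "down_cycle N (Suc r) = down_cycle N r \<circ> simple_refl (N - Suc r)"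

lemma down_cycle_apply:
  "r < N \<Longrightarrow> down_cycle N r i = (if i = N - r then N else if N - r < i \<and> i \<le> N then i - 1 else i)"
proof (induction r arbitrary: i)
  case (Suc r)
  have N: "Suc (N - Suc r) = N - r" using Suc.prems by simp
  show ?case
    using Suc by (auto simp: transpose_def N)
qed auto

lemma down_cycle_permutes: "r < N \<Longrightarrow> down_cycle N r permutes {N - r..N}"
proof (induction r)
  case (Suc r)
  have "down_cycle N r permutes {N - Suc r..N}"
    by (rule permutes_subset[OF Suc.IH]) (use Suc.prems in auto)
  moreover have "simple_refl (N - Suc r) permutes {N - Suc r..N}"
    by (rule permutes_swap_id) (use Suc.prems in auto)
  ultimately show ?case
    unfolding down_cycle.simps using permutes_compose by blast
qed simp

lemma young_subgroup_fixes: "u \<in> young_subgroup \<rho> \<Longrightarrow> sum_list \<rho> < i \<Longrightarrow> u i = i"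
  unfolding young_subgroup_def Sym_def using permutes_not_in by fastforce

text \<open>
  An element of the larger group is determined by the point \<open>N - r\<close> that it sends to the last point
  \<open>N\<close>, and by an element of the stabiliser of \<open>N\<close>.
\<close>

lemma young_subgroup_snoc_Suc:
  fixes \<rho> :: "nat list" and a :: nat
  defines "N \<equiv> sum_list \<rho> + Suc a"
  shows "bij_betw (\<lambda>(u, r). u \<circ> down_cycle N r) (young_subgroup (\<rho> @ [a]) \<times> {0..a})
    (young_subgroup (\<rho> @ [Suc a]))"
proof -
  have fixN: "u N = N" if "u \<in> young_subgroup (\<rho> @ [a])" for u
    using young_subgroup_fixes[OF that] by (simp add: N_def)
  have dN: "down_cycle N r (N - r) = N" if "r \<le> a" for r
    using that by (simp add: down_cycle_apply N_def)
  have dblock: "down_cycle N r ` block \<rho> j = block \<rho> j" if "r \<le> a" for r j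
  proof -
    have "down_cycle N r i = i" if "i \<in> block \<rho> j" for i
    proof -
      have "i < N - r" "r < N"
        using subsetD[OF block_subset that] \<open>r \<le> a\<close> by (auto simp: N_def)
      then show ?thesis by (simp add: down_cycle_apply)
    qed
    then show ?thesis by simp
  qed
  have dperm: "down_cycle N r permutes {sum_list \<rho><..N}" if "r \<le> a" for r
    by (rule permutes_subset[OF down_cycle_permutes]) (use that in \<open>auto simp: N_def\<close>)
  have dperm': "down_cycle N r permutes {1..N}" if "r \<le> a" for r
    by (rule permutes_subset[OF dperm[OF that]]) auto
  have last: "{sum_list \<rho><..N} = insert N {sum_list \<rho><..sum_list \<rho> + a}"
    by (auto simp: N_def)
  have mem: "u \<circ> down_cycle N r \<in> young_subgroup (\<rho> @ [Suc a])"
    if u: "u \<in> young_subgroup (\<rho> @ [a])" and r: "r \<le> a" for u r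
  proof -
    have up: "u permutes {1..sum_list \<rho> + a}"
      and ub: "\<And>j. j < length \<rho> \<Longrightarrow> u ` block \<rho> j = block \<rho> j"
      and ul: "u ` {sum_list \<rho><..sum_list \<rho> + a} = {sum_list \<rho><..sum_list \<rho> + a}"
      using u unfolding young_subgroup_snoc Sym_def mem_Collect_eq by blast+
    have "u permutes {1..N}"
      by (rule permutes_subset[OF up]) (auto simp: N_def)
    then have "u \<circ> down_cycle N r permutes {1..N}"
      by (rule permutes_compose[OF dperm'[OF r]])
    moreover have "(u \<circ> down_cycle N r) ` block \<rho> j = block \<rho> j" if "j < length \<rho>" for j
      using ub[OF that] dblock[OF r] by (metis image_comp)
    moreover have "(u \<circ> down_cycle N r) ` {sum_list \<rho><..N} = {sum_list \<rho><..N}"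
    proof -
      have "(u \<circ> down_cycle N r) ` {sum_list \<rho><..N} = u ` {sum_list \<rho><..N}"
        using permutes_image[OF dperm[OF r]] by (metis image_comp)
      also have "\<dots> = {sum_list \<rho><..N}"
        unfolding last using fixN[OF u] ul by simp
      finally show ?thesis .
    qed
    ultimately show ?thesis
      unfolding young_subgroup_snoc Sym_def N_def by simp
  qed
  have surj: "w \<in> (\<lambda>(u, r). u \<circ> down_cycle N r) ` (young_subgroup (\<rho> @ [a]) \<times> {0..a})"
    if w: "w \<in> young_subgroup (\<rho> @ [Suc a])" for w
  proof -
    have wp: "w permutes {1..N}"
      and wb: "\<And>j. j < length \<rho> \<Longrightarrow> w ` block \<rho> j = block \<rho> j"
      and wl: "w ` {sum_list \<rho><..N} = {sum_list \<rho><..N}"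
      using w unfolding young_subgroup_snoc Sym_def mem_Collect_eq N_def by blast+
    have "N \<in> w ` {sum_list \<rho><..N}" unfolding wl by (simp add: N_def)
    then obtain j where j: "sum_list \<rho> < j" "j \<le> N" "w j = N" by auto
    define r where "r = N - j"
    have r: "r \<le> a" and jr: "j = N - r" using j by (auto simp: r_def N_def)
    let ?d = "down_cycle N r"
    define u where "u = w \<circ> inv ?d"
    have dp: "?d permutes {1..N}" by (rule dperm'[OF r])
    have ud: "u \<circ> ?d = w"
      unfolding u_def comp_assoc using permutes_inv_o(2)[OF dp] by simp
    have uN: "u N = N"
      using fun_cong[OF ud, of j] dN[OF r] j(3) jr by simp
    have uN': "u permutes {1..N}"
      unfolding u_def by (rule permutes_compose[OF permutes_inv[OF dp] wp])
    have "u permutes {1..sum_list \<rho> + a}"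
      by (rule permutes_superset[OF uN']) (use uN in \<open>auto simp: N_def le_Suc_eq\<close>)
    moreover have "u ` block \<rho> i = block \<rho> i" if "i < length \<rho>" for i
      using wb[OF that] dblock[OF r, of i] ud by (metis image_comp)
    moreover have "u ` {sum_list \<rho><..sum_list \<rho> + a} = {sum_list \<rho><..sum_list \<rho> + a}"
    proof -
      have "u ` {sum_list \<rho><..N} = {sum_list \<rho><..N}"
        using wl permutes_image[OF dperm[OF r]] ud by (metis image_comp)
      moreover have "{sum_list \<rho><..sum_list \<rho> + a} = {sum_list \<rho><..N} - {N}"
        by (auto simp: N_def)
      ultimately show ?thesis
        using uN permutes_inj[OF uN'] by (simp add: image_set_diff)
    qed
    ultimately have "u \<in> young_subgroup (\<rho> @ [a])"
      unfolding young_subgroup_snoc Sym_def by simp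
    then show ?thesis
      using ud r by (intro image_eqI[of _ _ "(u, r)"]) auto
  qed
  have inj: "u = u' \<and> r = r'"
    if u: "u \<in> young_subgroup (\<rho> @ [a])" "u' \<in> young_subgroup (\<rho> @ [a])" and r: "r \<le> a" "r' \<le> a"
      and eq: "u \<circ> down_cycle N r = u' \<circ> down_cycle N r'" for u u' r r'
  proof -
    have u'inj: "inj u'"
      using u(2) unfolding young_subgroup_snoc Sym_def by (auto dest: permutes_inj)
    have "inj (down_cycle N r')" by (rule permutes_inj[OF dperm'[OF r(2)]])
    have "u' (down_cycle N r' (N - r)) = u' (down_cycle N r' (N - r'))"
      using fun_cong[OF eq, of "N - r"] fixN[OF u(1)] fixN[OF u(2)] dN r by simp
    then have "N - r = N - r'"
      using u'inj \<open>inj (down_cycle N r')\<close> by (simp add: inj_eq)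
    then have rr: "r = r'" using r by (simp add: N_def)
    have "u = u'"
    proof
      fix i
      obtain k where "i = down_cycle N r k"
        using permutes_surj[OF dperm'[OF r(1)]] by (metis surjD)
      then show "u i = u' i"
        using fun_cong[OF eq, of k] rr by simp
    qed
    with rr show ?thesis by simp
  qed
  show ?thesis
    unfolding bij_betw_def
  proof
    show "inj_on (\<lambda>(u, r). u \<circ> down_cycle N r) (young_subgroup (\<rho> @ [a]) \<times> {0..a})"
    proof (rule inj_onI, clarify)
      fix u r u' r'
      assume uu': "u \<in> young_subgroup (\<rho> @ [a])" "u' \<in> young_subgroup (\<rho> @ [a])"
        and rr': "r \<in> {0..a}" "r' \<in> {0..a}" and eq: "u \<circ> down_cycle N r = u' \<circ> down_cycle N r'"
      have "r \<le> a" "r' \<le> a" using rr' by auto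
      then show "u = u' \<and> r = r'" by (rule inj[OF uu' _ _ eq])
    qed
    show "(\<lambda>(u, r). u \<circ> down_cycle N r) ` (young_subgroup (\<rho> @ [a]) \<times> {0..a}) =
        young_subgroup (\<rho> @ [Suc a])"
    proof (intro equalityI subsetI)
      fix w assume "w \<in> (\<lambda>(u, r). u \<circ> down_cycle N r) ` (young_subgroup (\<rho> @ [a]) \<times> {0..a})"
      then obtain u r where "u \<in> young_subgroup (\<rho> @ [a])" "r \<le> a" "w = u \<circ> down_cycle N r"
        by auto
      then show "w \<in> young_subgroup (\<rho> @ [Suc a])" using mem by blast
    qed (rule surj)
  qed
qed

text \<open>
  In the coset decomposition, \<open>down_cycle N (r + 1)\<close> is \<open>down_cycle N r\<close> times a simple reflection \<open>s\<close>.  For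
  \<open>r \<ge> 1\<close> this \<open>s\<close> commutes with \<open>x\<close>, which lives on \<open>{N..n}\<close>, and belongs to the last block, so
  \<open>expansion_shift\<close> moves it around the trace at the cost of a factor \<open>q\<close>.  The cosets with
  \<open>r = 1, \<dots>, a\<close> thus contribute \<open>1 + q + \<dots> + q\<^sup>a\<^sup>-\<^sup>1\<close> times the contribution of \<open>r = 1\<close>.
\<close>

lemma young_sum_Suc:
  fixes \<rho> :: "nat list" and a :: nat
  defines "N \<equiv> sum_list \<rho> + Suc a"
  assumes \<kappa>: "is_expansion_matrix n \<kappa>" and \<nu>: "\<nu> \<in> partitions n"
    and N: "N \<le> n" and x: "x permutes {N..n}"
  shows "(\<Sum>w\<in>young_subgroup (\<rho> @ [Suc a]). \<kappa> \<nu> (w \<circ> x)) =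
    (\<Sum>u\<in>young_subgroup (\<rho> @ [a]). \<kappa> \<nu> (u \<circ> x))
    + qint a * (\<Sum>u\<in>young_subgroup (\<rho> @ [a]). \<kappa> \<nu> (u \<circ> (simple_refl (N - 1) \<circ> x)))"
proof -
  let ?Y = "young_subgroup (\<rho> @ [a])"
  define F where "F = (\<lambda>r. \<Sum>u\<in>?Y. \<kappa> \<nu> (u \<circ> (down_cycle N r \<circ> x)))"
  have N1: "N \<ge> 1" by (simp add: N_def)
  have step: "F (Suc r) = q * F r" if r: "1 \<le> r" "Suc r \<le> a" for r
  proof -
    define k where "k = N - Suc r"
    have k: "k \<in> {1..<n}" "Suc k = N - r" "sum_list \<rho> < k" "Suc k < N"
      using r N by (auto simp: k_def N_def)
    have xk: "x i = i" if "i < N" for i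
      using permutes_not_in[OF x] that by simp
    have comm: "simple_refl k \<circ> x = x \<circ> simple_refl k"
    proof
      fix i
      have "x i \<in> {N..n}" if "i \<in> {N..n}"
        using permutes_in_image[OF x, of i] that by simp
      then show "(simple_refl k \<circ> x) i = (x \<circ> simple_refl k) i"
        using xk k permutes_not_in[OF x, of i] by (cases "i \<in> {N..n}") (auto simp: transpose_def)
    qed
    have "(\<Sum>u\<in>?Y. \<kappa> \<nu> (u \<circ> ((down_cycle N r \<circ> x) \<circ> simple_refl k))) = q * (\<Sum>u\<in>?Y. \<kappa> \<nu> (u \<circ> (down_cycle N r \<circ> x)))"
    proof (rule expansion_shift[OF \<kappa> \<nu> k(1)])
      fix u assume u: "u \<in> ?Y"
      have up: "u permutes {1..sum_list \<rho> + a}"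
        and ub: "\<And>j. j < length \<rho> \<Longrightarrow> u ` block \<rho> j = block \<rho> j"
        and ul: "u ` {sum_list \<rho><..sum_list \<rho> + a} = {sum_list \<rho><..sum_list \<rho> + a}"
        using u unfolding young_subgroup_snoc Sym_def mem_Collect_eq by blast+
      let ?s = "simple_refl k"
      have sp: "?s permutes {sum_list \<rho><..sum_list \<rho> + a}"
        by (rule permutes_swap_id) (use k in \<open>auto simp: N_def\<close>)
      have "?s permutes {1..sum_list \<rho> + a}"
        by (rule permutes_subset[OF sp]) auto
      then have "?s \<circ> u permutes {1..sum_list \<rho> + a}"
        by (rule permutes_compose[OF up])
      moreover have "(?s \<circ> u) ` block \<rho> j = block \<rho> j" if "j < length \<rho>" for j
      proof -
        have "?s i = i" if "i \<in> block \<rho> j" for i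
          using that block_subset[of \<rho> j] k(3) by (auto simp: transpose_def)
        then have "?s ` block \<rho> j = block \<rho> j" by simp
        then show ?thesis using ub[OF that] by (metis image_comp)
      qed
      moreover have "(?s \<circ> u) ` {sum_list \<rho><..sum_list \<rho> + a} = {sum_list \<rho><..sum_list \<rho> + a}"
        using permutes_image[OF sp] ul by (metis image_comp)
      ultimately show "?s \<circ> u \<in> ?Y"
        unfolding young_subgroup_snoc Sym_def by blast
      have "u permutes {1..n}"
        by (rule permutes_subset[OF up]) (use N in \<open>auto simp: N_def\<close>)
      moreover have "down_cycle N r permutes {1..n}"
        by (rule permutes_subset[OF down_cycle_permutes]) (use N r in \<open>auto simp: N_def\<close>)
      moreover have "x permutes {1..n}"
        by (rule permutes_subset[OF x]) (use N1 in auto)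
      ultimately show "u \<circ> (down_cycle N r \<circ> x) \<in> Sym n"
        unfolding Sym_def by (auto intro: permutes_compose)
      have "u k \<in> {1..sum_list \<rho> + a}"
        using permutes_in_image[OF up, of k] k by (simp add: N_def)
      moreover have "(u \<circ> (down_cycle N r \<circ> x)) k = u k"
        using k r by (simp add: xk down_cycle_apply N_def)
      moreover have "(u \<circ> (down_cycle N r \<circ> x)) (Suc k) = N"
        using k r young_subgroup_fixes[OF u, of N] by (simp add: xk down_cycle_apply N_def)
      ultimately show "(u \<circ> (down_cycle N r \<circ> x)) k < (u \<circ> (down_cycle N r \<circ> x)) (Suc k)"
        by (simp add: N_def)
    qed
    then show ?thesis
      unfolding F_def down_cycle.simps by (simp only: comp_assoc comm flip: k_def)
  qed
  have pow: "F (Suc r) = q ^ r * F 1" if "r < a" for r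
    using that
  proof (induction r)
    case (Suc r)
    then show ?case using step[of "Suc r"] by simp
  qed simp
  have "(\<Sum>w\<in>young_subgroup (\<rho> @ [Suc a]). \<kappa> \<nu> (w \<circ> x)) =
      (\<Sum>(u, r)\<in>?Y \<times> {0..a}. \<kappa> \<nu> (u \<circ> down_cycle N r \<circ> x))"
    using sum.reindex_bij_betw[OF young_subgroup_snoc_Suc[of \<rho> a], of "\<lambda>w. \<kappa> \<nu> (w \<circ> x)"]
    by (simp only: case_prod_unfold flip: N_def)
  also have "\<dots> = (\<Sum>r=0..a. F r)"
    unfolding F_def by (subst sum.swap) (simp only: sum.cartesian_product comp_assoc)
  also have "\<dots> = F 0 + (\<Sum>r<a. F (Suc r))"
    unfolding atLeast0AtMost by (rule sum.atMost_shift)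
  also have "(\<Sum>r<a. F (Suc r)) = qint a * F 1"
    unfolding qint_def sum_distrib_right by (intro sum.cong refl pow) (simp only: lessThan_iff)
  also have "F 1 = (\<Sum>u\<in>?Y. \<kappa> \<nu> (u \<circ> (simple_refl (N - 1) \<circ> x)))"
    unfolding F_def by (simp only: One_nat_def down_cycle.simps id_comp)
  also have "F 0 = (\<Sum>u\<in>?Y. \<kappa> \<nu> (u \<circ> x))"
    unfolding F_def by (simp only: down_cycle.simps id_comp)
  finally show ?thesis .
qed


text \<open>
  Iteration of \<open>young_sum_Suc\<close>: in each step the last point leaves the last block, and the cycle
  through this point is either complete or extended to the preceding point.  For the sums
  \<open>E\<^sub>n = \<Sum> T\<^sub>w / [n]!\<close> over \<open>S\<^sub>n\<close> and Coxeter elements \<open>\<gamma>\<^sub>k\<close> of \<open>S\<^sub>k\<close>, the case \<open>b = 0\<close> reads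
  \<open>[n] E\<^sub>n = \<Sum> E\<^sub>n\<^sub>-\<^sub>k \<gamma>\<^sub>k\<close> under every trace.
\<close>

lemma young_sum_peel:
  fixes \<rho> :: "nat list"
  assumes \<kappa>: "is_expansion_matrix n \<kappa>" and \<nu>: "\<nu> \<in> partitions n"
    and n: "sum_list \<rho> + Suc a + b + sum_list \<alpha> = n" and \<alpha>: "0 \<notin> set \<alpha>"
  defines "U \<equiv> \<lambda>m \<beta>. \<Sum>w\<in>young_subgroup (\<rho> @ [m]). \<kappa> \<nu> (w \<circ> coxeter (sum_list \<rho> + m) \<beta>)"
  shows "(\<Sum>w\<in>young_subgroup (\<rho> @ [Suc a]).
      \<kappa> \<nu> (w \<circ> (up_cycle (sum_list \<rho> + Suc a) b \<circ> coxeter (sum_list \<rho> + Suc a + b) \<alpha>))) =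
    (\<Sum>k=1..Suc a. qfact a / qfact (Suc a - k) * U (Suc a - k) ((k + b) # \<alpha>))"
  using n
proof (induction a arbitrary: b)
  case (0 b)
  let ?N = "sum_list \<rho> + Suc 0"
  have x: "up_cycle ?N b \<circ> coxeter (?N + b) \<alpha> permutes {?N..n}"
    by (rule permutes_compose[OF permutes_subset[OF coxeter_permutes[OF \<alpha>]] permutes_subset[OF up_cycle_permutes]])
      (use 0 in auto)
  have eq: "up_cycle ?N b \<circ> coxeter (?N + b) \<alpha> = coxeter (sum_list \<rho> + 0) (Suc b # \<alpha>)"
    by simp
  have "sum_list \<rho> + Suc 0 \<le> n" using 0 by simp
  from young_sum_Suc[OF \<kappa> \<nu> this x]
  have "(\<Sum>w\<in>young_subgroup (\<rho> @ [Suc 0]). \<kappa> \<nu> (w \<circ> (up_cycle ?N b \<circ> coxeter (?N + b) \<alpha>))) = U 0 (Suc b # \<alpha>)"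
    unfolding U_def eq[symmetric] by (simp only: qint_def lessThan_0 sum.empty mult_zero_left add_0_right)
  moreover have "(\<Sum>k=1..Suc 0. qfact 0 / qfact (Suc 0 - k) * U (Suc 0 - k) ((k + b) # \<alpha>)) = U 0 (Suc b # \<alpha>)"
    by (simp add: qfact_def)
  ultimately show ?case
    by (simp only:)
next
  case (Suc a b)
  let ?N = "sum_list \<rho> + Suc (Suc a)"
  have x: "up_cycle ?N b \<circ> coxeter (?N + b) \<alpha> permutes {?N..n}"
    by (rule permutes_compose[OF permutes_subset[OF coxeter_permutes[OF \<alpha>]] permutes_subset[OF up_cycle_permutes]])
      (use Suc.prems in auto)
  have eq: "up_cycle ?N b \<circ> coxeter (?N + b) \<alpha> = coxeter (sum_list \<rho> + Suc a) (Suc b # \<alpha>)"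
    by simp
  have eq': "simple_refl (?N - 1) \<circ> (up_cycle ?N b \<circ> coxeter (?N + b) \<alpha>) =
      up_cycle (sum_list \<rho> + Suc a) (Suc b) \<circ> coxeter (sum_list \<rho> + Suc a + Suc b) \<alpha>"
    by (simp add: comp_assoc)
  have IH: "(\<Sum>w\<in>young_subgroup (\<rho> @ [Suc a]).
      \<kappa> \<nu> (w \<circ> (up_cycle (sum_list \<rho> + Suc a) (Suc b) \<circ> coxeter (sum_list \<rho> + Suc a + Suc b) \<alpha>))) =
    (\<Sum>k=1..Suc a. qfact a / qfact (Suc a - k) * U (Suc a - k) ((k + Suc b) # \<alpha>))"
    by (rule Suc.IH) (use Suc.prems in simp)
  have "(\<Sum>w\<in>young_subgroup (\<rho> @ [Suc (Suc a)]). \<kappa> \<nu> (w \<circ> (up_cycle ?N b \<circ> coxeter (?N + b) \<alpha>))) =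
      U (Suc a) (Suc b # \<alpha>) + qint (Suc a) *
      (\<Sum>w\<in>young_subgroup (\<rho> @ [Suc a]). \<kappa> \<nu> (w \<circ> (simple_refl (?N - 1) \<circ> (up_cycle ?N b \<circ> coxeter (?N + b) \<alpha>))))"
    unfolding U_def eq[symmetric] by (rule young_sum_Suc[OF \<kappa> \<nu> _ x]) (use Suc.prems in simp)
  also have "\<dots> = U (Suc a) (Suc b # \<alpha>) +
      (\<Sum>k=1..Suc a. qfact (Suc a) / qfact (Suc a - k) * U (Suc a - k) ((k + Suc b) # \<alpha>))"
    unfolding eq' IH sum_distrib_left qfact_Suc by (simp only: times_divide_eq_right mult.assoc times_divide_eq_left)
  also have "\<dots> = (\<Sum>k=1..Suc (Suc a). qfact (Suc a) / qfact (Suc (Suc a) - k) * U (Suc (Suc a) - k) ((k + b) # \<alpha>))"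
    by (simp add: sum.atLeast_Suc_atMost_Suc_shift sum.atLeast_Suc_atMost del: sum.cl_ivl_Suc)
  finally show ?case .
qed


section \<open>Young subgroup sums as principal specialisations\<close>

text \<open>
  The recursion of \<open>young_sum_peel\<close> is the recursion that defines \<open>spec\<close>, up to a factor
  \<open>q\<^sup>-\<^sup>k (q - 1)\<close> for each part \<open>k\<close> that is split off; this accounts for the powers of \<open>q\<close> and
  \<open>q - 1\<close>.  The last block is processed first, so the blocks are listed in reverse.
\<close>

theorem young_sum_eq_pspec:
  assumes \<kappa>: "is_expansion_matrix n \<kappa>" and \<nu>: "\<nu> \<in> partitions n"
    and "sum_list \<rho> + sum_list \<alpha> = n" and "0 \<notin> set \<alpha>"
  shows "(\<Sum>w\<in>young_subgroup (rev \<rho>). \<kappa> \<nu> (w \<circ> coxeter (sum_list \<rho>) \<alpha>)) =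
    qfact_part \<rho> / q ^ sum_list \<rho> *
    pspec \<rho> (\<lambda>M. (q - 1) ^ size M * (if M + mset \<alpha> = mset \<nu> then 1 else 0))"
  using assms(3,4)
proof (induction \<rho> arbitrary: \<alpha>)
  case Nil
  have "young_subgroup [] = {id}"
    by (simp add: young_subgroup_def Sym_def)
  then show ?case
    using expansion_matrix_coxeter[OF \<kappa> \<nu>, of \<alpha>] Nil by (simp add: qfact_part_def)
next
  case (Cons a \<rho>)
  define \<phi> where "\<phi> = (\<lambda>\<alpha> M. (q - 1) ^ size M * (if M + mset \<alpha> = mset \<nu> then 1 else 0 :: qfield))"
  show ?case
    using Cons.prems
  proof (induction a arbitrary: \<alpha> rule: less_induct)
    case (less a)
    show ?case
    proof (cases a)
      case 0
      then show ?thesis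
        using Cons.IH[of \<alpha>] less.prems by (simp add: qfact_part_def qfact_def)
    next
      case (Suc m)
      define c where "c = qfact_part \<rho> / q ^ sum_list \<rho>"
      define P where "P = (\<lambda>k. spec (a - k) (\<lambda>A. pspec \<rho> (\<lambda>B. \<phi> \<alpha> (add_mset k (A + B)))))"
      have \<phi>: "(q - 1) * \<phi> (k # \<alpha>) M = \<phi> \<alpha> (add_mset k M)" for k M
        by (simp add: \<phi>_def)
      have IH: "(\<Sum>w\<in>young_subgroup (rev \<rho> @ [a - k]). \<kappa> \<nu> (w \<circ> coxeter (sum_list (rev \<rho>) + (a - k)) (k # \<alpha>))) =
          qfact (a - k) * c / q ^ (a - k) / (q - 1) * P k" if k: "k \<in> {1..a}" for k
      proof -
        have "(\<Sum>w\<in>young_subgroup (rev ((a - k) # \<rho>)). \<kappa> \<nu> (w \<circ> coxeter (sum_list ((a - k) # \<rho>)) (k # \<alpha>))) =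
            qfact_part ((a - k) # \<rho>) / q ^ sum_list ((a - k) # \<rho>) * pspec ((a - k) # \<rho>) (\<phi> (k # \<alpha>))"
          unfolding \<phi>_def by (rule less.IH) (use k less.prems in auto)
        moreover have "(q - 1) * pspec ((a - k) # \<rho>) (\<phi> (k # \<alpha>)) = P k"
          unfolding P_def \<phi>[symmetric] by (simp add: pspec_scale spec_scale)
        then have "pspec ((a - k) # \<rho>) (\<phi> (k # \<alpha>)) = P k / (q - 1)"
          by (simp add: field_simps)
        ultimately show ?thesis
          by (simp add: c_def qfact_part_def power_add add.commute mult_ac del: coxeter.simps)
      qed
      have "(\<Sum>w\<in>young_subgroup (rev (a # \<rho>)). \<kappa> \<nu> (w \<circ> coxeter (sum_list (a # \<rho>)) \<alpha>)) =
          (\<Sum>w\<in>young_subgroup (rev \<rho> @ [Suc m]). \<kappa> \<nu> (w \<circ>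
            (up_cycle (sum_list (rev \<rho>) + Suc m) 0 \<circ> coxeter (sum_list (rev \<rho>) + Suc m + 0) \<alpha>)))"
        by (simp add: Suc add_ac)
      also have "\<dots> = (\<Sum>k=1..Suc m. qfact m / qfact (Suc m - k) *
          (\<Sum>w\<in>young_subgroup (rev \<rho> @ [Suc m - k]). \<kappa> \<nu> (w \<circ> coxeter (sum_list (rev \<rho>) + (Suc m - k)) ((k + 0) # \<alpha>))))"
        by (rule young_sum_peel[OF \<kappa> \<nu>]) (use less.prems Suc in auto)
      also have "\<dots> = (\<Sum>k=1..a. qfact m / qfact (a - k) * (qfact (a - k) * c / q ^ (a - k) / (q - 1) * P k))"
        unfolding Suc[symmetric] add_0_right by (intro sum.cong refl) (simp only: IH)
      also have "\<dots> = (\<Sum>k=1..a. qfact m * c / q ^ a / (q - 1) * (q ^ k * P k))"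
        by (intro sum.cong refl) (simp add: power_diff field_simps)
      also have "\<dots> = qfact m * c / q ^ a / (q - 1) * ((q ^ a - 1) * pspec (a # \<rho>) (\<phi> \<alpha>))"
        unfolding sum_distrib_left[symmetric] P_def pspec.simps spec_rec by simp
      also have "\<dots> = qint a * qfact m * c / q ^ a * pspec (a # \<rho>) (\<phi> \<alpha>)"
        by (simp add: qint_altdef mult_ac)
      also have "qint a * qfact m = qfact a"
        by (simp only: Suc qfact_Suc)
      finally show ?thesis
        unfolding \<phi>_def c_def by (simp only: qfact_part_def list.map prod_list.Cons sum_list.Cons power_add) (simp add: mult_ac)
    qed
  qed
qed


section \<open>The coefficients of the plethysm\<close>

theorem corollary4p2:
  fixes n :: nat
    and \<Phi> :: "qfield symfun \<Rightarrow> qfield symfun"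
    and \<kappa> :: "nat list \<Rightarrow> (nat \<Rightarrow> nat) \<Rightarrow> qfield"
    and R :: "nat list \<Rightarrow> nat list \<Rightarrow> qfield"
    and \<nu> \<pi> :: "nat list"
  assumes "n > 0"
    and "is_plethysm \<Phi>"
    and "is_expansion_matrix n \<kappa>"
    and "\<And>\<nu>. \<nu> \<in> partitions n \<Longrightarrow>
           \<Phi> (monomial_sym \<nu>) = (\<Sum>\<pi>\<in>partitions n. sscale (R \<nu> \<pi>) (monomial_sym \<pi>))"
    and "\<nu> \<in> partitions n"
    and "\<pi> \<in> partitions n"
  shows "R \<nu> \<pi> =
    (\<Sum>w\<in>Sym n. (1 / (1 - inverse q)) ^ length \<nu> * q ^ (n - length \<nu>)
       * \<kappa> \<nu> w * contraction w \<pi> * (1 / qfact_part \<pi>))"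
proof -
  define L where "L = length \<nu>"
  define W where "W = pspec (rev \<pi>) (\<lambda>M. if M = mset \<nu> then 1 else 0)"
  have \<pi>: "0 \<notin> set \<pi>" "sum_list \<pi> = n" and \<nu>: "0 \<notin># mset \<nu>" "sum_list \<nu> = n"
    using assms(5,6) by (auto simp: partitions_def)
  have L: "L \<le> n"
  proof -
    have "0 \<notin> set xs \<Longrightarrow> length xs \<le> sum_list xs" for xs :: "nat list"
      by (induction xs) auto
    then show ?thesis using \<nu> unfolding L_def by auto
  qed

  have "R \<nu> \<pi> = W"
  proof -
    \<comment> \<open>The coefficient of \<open>m\<^sub>\<pi>\<close> can be read off at any rearrangement of \<open>\<pi>\<close>; the reversed one fits \<open>young_sum_eq_pspec\<close>.\<close>
    have exps: "exponents (Poly_Mapping.nth (rev \<pi>)) = mset \<pi>"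
    proof -
      have keys: "Poly_Mapping.keys (Poly_Mapping.nth (rev \<pi>)) = {..<length (rev \<pi>)}"
      proof -
        have "rev \<pi> ! i \<noteq> 0" if "i < length (rev \<pi>)" for i
          using nth_mem[OF that] \<pi>(1) by (metis set_rev)
        then show ?thesis
          by (auto simp: in_keys_iff nth_default_def simp del: keys_nth split: if_splits)
      qed
      have "exponents (Poly_Mapping.nth (rev \<pi>)) = image_mset ((!) (rev \<pi>)) (mset_set {..<length (rev \<pi>)})"
        unfolding exponents_def keys by (intro image_mset_cong) (simp add: nth_default_def)
      also have "\<dots> = mset (map ((!) (rev \<pi>)) [0..<length (rev \<pi>)])"
        by (simp only: mset_map mset_upt atLeast0LessThan)
      also have "\<dots> = mset \<pi>"
        by (simp only: map_nth mset_rev)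
      finally show ?thesis .
    qed
    have "W = mcoeff (\<Phi> (monomial_sym \<nu>)) (Poly_Mapping.nth (rev \<pi>))"
      unfolding W_def monomial_sym_eq_msym mcoeff_plethysm_msym[OF assms(2) \<nu>(1)] ..
    also have "\<dots> = (\<Sum>\<rho>\<in>partitions n. R \<nu> \<rho> * (if mset \<pi> = mset \<rho> then 1 else 0))"
      unfolding assms(4)[OF assms(5)] by (simp add: mcoeff_sum sscale.rep_eq monomial_sym.rep_eq exps)
    also have "\<dots> = (\<Sum>\<rho>\<in>partitions n. if \<rho> = \<pi> then R \<nu> \<rho> else 0)"
    proof (intro sum.cong refl)
      fix \<rho> assume "\<rho> \<in> partitions n"
      then have "mset \<pi> = mset \<rho> \<longleftrightarrow> \<rho> = \<pi>"
        using assms(6) partition_mset_inject by blast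
      then show "R \<nu> \<rho> * (if mset \<pi> = mset \<rho> then 1 else 0) = (if \<rho> = \<pi> then R \<nu> \<rho> else 0)"
        by simp
    qed
    also have "\<dots> = R \<nu> \<pi>"
      using assms(6) finite_partitions by simp
    finally show ?thesis ..
  qed

  moreover have "(\<Sum>w\<in>young_subgroup \<pi>. \<kappa> \<nu> w) = qfact_part \<pi> / q ^ n * ((q - 1) ^ L * W)"
  proof -
    have "(\<Sum>w\<in>young_subgroup (rev (rev \<pi>)). \<kappa> \<nu> (w \<circ> coxeter (sum_list (rev \<pi>)) [])) =
        qfact_part (rev \<pi>) / q ^ sum_list (rev \<pi>) *
        pspec (rev \<pi>) (\<lambda>M. (q - 1) ^ size M * (if M + mset [] = mset \<nu> then 1 else 0))"
      by (rule young_sum_eq_pspec[OF assms(3,5)]) (use \<pi> in simp_all)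
    also have "(\<lambda>M. (q - 1) ^ size M * (if M + mset [] = mset \<nu> then 1 else 0)) =
        (\<lambda>M. (q - 1) ^ L * (if M = mset \<nu> then 1 else 0))"
      by (auto simp: L_def)
    also have "pspec (rev \<pi>) \<dots> = (q - 1) ^ L * W"
      unfolding W_def by (rule pspec_scale)
    finally show ?thesis
      using \<pi>(2) by (simp add: qfact_part_def rev_map flip: rev_map)
  qed

  moreover have "(\<Sum>w\<in>Sym n. (1 / (1 - inverse q)) ^ length \<nu> * q ^ (n - length \<nu>)
       * \<kappa> \<nu> w * contraction w \<pi> * (1 / qfact_part \<pi>)) =
      (1 / (1 - inverse q)) ^ L * q ^ (n - L) / qfact_part \<pi> * (\<Sum>w\<in>young_subgroup \<pi>. \<kappa> \<nu> w)"
  proof -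
    have "young_subgroup \<pi> \<subseteq> Sym n"
      using \<pi>(2) by (auto simp: young_subgroup_def)
    then have "(\<Sum>w\<in>young_subgroup \<pi>. \<kappa> \<nu> w) = (\<Sum>w\<in>Sym n. \<kappa> \<nu> w * contraction w \<pi>)"
      by (intro sum.mono_neutral_cong_left) (auto simp: contraction_def)
    then show ?thesis
      by (simp add: sum_distrib_left sum_divide_distrib L_def mult_ac)
  qed

  moreover have "(1 / (1 - inverse q)) ^ L * q ^ (n - L) / qfact_part \<pi> *
      (qfact_part \<pi> / q ^ n * ((q - 1) ^ L * W)) = W"
  proof -
    have "1 / (1 - inverse q) * (q - 1) = q"
      by (simp add: field_simps)
    then have "(1 / (1 - inverse q)) ^ L * (q - 1) ^ L = q ^ L"
      by (simp only: flip: power_mult_distrib)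
    then have "(1 / (1 - inverse q)) ^ L * q ^ (n - L) * (q - 1) ^ L = q ^ L * q ^ (n - L)"
      by (simp only: mult_ac)
    also have "\<dots> = q ^ n"
      using L by (simp flip: power_add)
    finally have prefactor: "(1 / (1 - inverse q)) ^ L * q ^ (n - L) * (q - 1) ^ L = q ^ n" .
    have cancel: "x / f * (f / z * (y * W)) = (x * y) / z * W" if "f \<noteq> 0" for x y z f :: qfield
      using that by simp
    show ?thesis
      unfolding cancel[OF qfact_part_nonzero] prefactor by simp
  qed
  ultimately show ?thesis
    by (simp only:)
qed

end
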